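(* Let $\sigma$ be a strictly convex rational polyhedral cone in $N\otimes_{\mathbb Z}\mathbb{R}$, let $S=K[\mathbb{N}^{\sigma(1)}]$, and let $E$ be an $M$-graded $K[\sigma_M]$-module. Let $\widehat{E}=\bigoplus_{\underline c\in\mathbb{Z}^{\sigma(1)}}\widehat{E}_{\underline c}$ be the $\mathbb{Z}^{\sigma(1)}$-graded lifting of the sheaf on the affine toric variety $U_\sigma$ associated to $E$, and let $\overline{E}=\bigoplus_{\underline c\in\mathbb{Z}^{\sigma(1)}}\overline{E}_{\underline c}$ be the $\mathbb{Z}^{\sigma(1)}$-graded $S$-module with $\overline{E}_{\underline c}=\varprojlim_{m\in U_{\underline c}}E_m$. Then the graded $S$-modules $\widehat{E}$ and $\overline{E}$ are naturally isomorphic. In particular, for every $\underline c\in\mathbb{Z}^{\sigma(1)}$ the vector space $\widehat{E}_{\underline c}=\operatorname{Hom}^M_{K[\sigma_M]}(S_{(-\underline c)},E)$ is naturally isomorphic to $\overline{E}_{\underline c}$.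
   Context: $K$ is an algebraically closed field, $M\cong\mathbb{Z}^d$ is the character group of the torus $T$, $N=M^*$ its dual lattice. For a strictly convex rational polyhedral cone $\sigma\subset N\otimes_{\mathbb Z}\mathbb{R}$, $\sigma(1)$ is its set of rays, $l_\rho\in N$ the primitive vector of $\rho\in\sigma(1)$ (viewed as a linear form on $M$), $\sigma_M=\check\sigma\cap M$ with $\check\sigma$ the dual cone in $M\otimes_{\mathbb Z}\mathbb{R}$, and $U_\sigma=\operatorname{Spec}K[\sigma_M]$. For $m\in M$, $\chi(m)$ is the corresponding element of $K[M]$. Toric (i.e. $T$-equivariant quasi-coherent) sheaves on $U_\sigma$ are equivalent to $M$-graded $K[\sigma_M]$-modules. $\operatorname{Hom}^M_{K[\sigma_M]}$ denotes $M$-degree-preserving homomorphisms. Write $m\leq_\sigma m'$ iff $m'-m\in\sigma_M$; this is a preorder on $M$, regarded as a small category with a unique morphism $m\to m'$ when $m\leq_\sigma m'$. An $M$-graded $K[\sigma_M]$-module $E$ is the same as a functor $m\mapsto E_m$ from $(M,\leq_\sigma)$ to $K$-vector spaces, the map $E_m\to E_{m'}$ being multiplication by $\chi(m'-m)$. Let $L_\sigma:M\to\mathbb{Z}^{\sigma(1)}$, $L_\sigma(m)=(l_\rho(m))_\rho$, and let $\leq$ be the componentwise partial order on $\mathbb{Z}^{\sigma(1)}$. For $\underline c\in\mathbb{Z}^{\sigma(1)}$ put $U_{\underline c}=\{m\in M\mid\underline c\leq L_\sigma(m)\}$ and $\overline{E}_{\underline c}=\varprojlim_{m\in U_{\underline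 c}}E_m$. For $\underline c\leq\underline c'$ one has $U_{\underline c'}\subseteq U_{\underline c}$ and a restriction map $\overline{E}_{\underline c}\to\overline{E}_{\underline c'}$, and these make $\overline E=\bigoplus_{\underline c}\overline{E}_{\underline c}$ a $\mathbb{Z}^{\sigma(1)}$-graded $S$-module (the monomial $x^{\underline a}\in S$ acts by the restriction map $\overline{E}_{\underline c}\to\overline{E}_{\underline c+\underline a}$). Lifting: for $\underline c\in\mathbb{Z}^{\sigma(1)}$ let $S_{(\underline c)}$ be the $M$-graded $K[\sigma_M]$-submodule $\bigoplus_{m\in M,\ l_\rho(m)\geq -c_\rho\ \forall\rho\in\sigma(1)}K\chi(m)$ of $K[M]$. The lifting of the sheaf associated to $E$ is $\widehat{E}=\bigoplus_{\underline c}\operatorname{Hom}^M_{K[\sigma_M]}(S_{(\underline c)},E)$ with grading convention $\widehat{E}_{\underline c}=\operatorname{Hom}^M_{K[\sigma_M]}(S_{(-\underline c)},E)$; the monomial $x^{\underline a}$, $\underline a\in\mathbb{N}^{\sigma(1)}$, acts as the map $\widehat{E}_{\underline c}\to\widehat{E}_{\underline c+\underline a}$ given by restriction along the inclusion $S_{(-\underline c-\underline a)}\subseteq S_{(-\underline c)}$. *)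

theory Defs
  imports
    "HOL-Analysis.Analysis"
    "HOL-Library.Poly_Mapping"
    "HOL-Algebra.AbelCoset"
    "HOL-Algebra.Module"
    "HOL-Algebra.Algebraic_Closure_Type"
begin

section \<open>The lattice and its real dual space\<close>

text \<open>
  The character lattice is the additive group of a type \<open>'m\<close>; that it is isomorphic to
  \<open>\<int>^d\<close> is stated by the following predicate (the rank \<open>d = 0\<close> is allowed).
\<close>

definition free_abelian_of_rank :: "'m::ab_group_add itself \<Rightarrow> nat \<Rightarrow> bool" where
  "free_abelian_of_rank _ d \<longleftrightarrow>
     (\<exists>\<phi> :: 'm \<Rightarrow> nat \<Rightarrow> int. bij_betw \<phi> UNIV {v. \<forall>i\<ge>d. v i = 0} \<and>
        (\<forall>m m'. \<phi> (m + m') = (\<lambda>i. \<phi> m i + \<phi> m' i)))"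

text \<open>
  For \<open>M\<close> free of finite rank and \<open>N = Hom(M, \<int>)\<close>, the space \<open>N \<otimes> \<real>\<close> is canonically
  \<open>Hom(M, \<real>)\<close>, with \<open>N\<close> embedded as the integer valued homomorphisms.
\<close>

typedef (overloaded) ('m::ab_group_add) N_real =
    "{f :: 'm \<Rightarrow> real. \<forall>m m'. f (m + m') = f m + f m'}"
  morphisms pairing Abs_N_real
  by (rule exI[of _ "\<lambda>_. 0"]) simp

setup_lifting type_definition_N_real

instantiation N_real :: (ab_group_add) real_vector
begin

lift_definition zero_N_real :: "'a N_real" is "\<lambda>_. 0" by simp
lift_definition plus_N_real :: "'a N_real \<Rightarrow> 'a N_real \<Rightarrow> 'a N_real"
  is "\<lambda>f g m. f m + g m" by simp
lift_definition uminus_N_real :: "'a N_real \<Rightarrow> 'a N_real" is "\<lambda>f m. - f m" by simp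
lift_definition minus_N_real :: "'a N_real \<Rightarrow> 'a N_real \<Rightarrow> 'a N_real"
  is "\<lambda>f g m. f m - g m" by simp
lift_definition scaleR_N_real :: "real \<Rightarrow> 'a N_real \<Rightarrow> 'a N_real"
  is "\<lambda>r f m. r * f m" by (simp add: algebra_simps)

instance
  by standard (transfer; force simp: algebra_simps)+

end

definition N_lattice :: "'m::ab_group_add N_real set" where
  "N_lattice = {v. \<forall>m. pairing v m \<in> \<int>}"


section \<open>Cones\<close>

definition rational_polyhedral_cone :: "'m::ab_group_add N_real set \<Rightarrow> bool" where
  "rational_polyhedral_cone \<sigma> \<longleftrightarrow>
     (\<exists>G. finite G \<and> G \<subseteq> N_lattice \<and> \<sigma> = convex_cone hull G)"

definition strictly_convex_cone :: "'v::real_vector set \<Rightarrow> bool" where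
  "strictly_convex_cone \<sigma> \<longleftrightarrow> \<sigma> \<inter> uminus ` \<sigma> = {0}"

definition rays :: "'v::real_vector set \<Rightarrow> 'v set set" where
  "rays \<sigma> = {\<rho>. \<rho> face_of \<sigma> \<and> dim \<rho> = 1}"

text \<open>The primitive vector of a rational ray is the generator of its monoid of lattice points.\<close>

definition primitive_vector :: "'m::ab_group_add N_real set \<Rightarrow> 'm N_real" where
  "primitive_vector \<rho> =
     (THE l. \<rho> \<inter> N_lattice = range (\<lambda>k::nat. real k *\<^sub>R l))"

definition sigma_M :: "'m::ab_group_add N_real set \<Rightarrow> 'm set" where
  "sigma_M \<sigma> = {m. \<forall>v\<in>\<sigma>. 0 \<le> pairing v m}"

definition le_cone :: "'m::ab_group_add N_real set \<Rightarrow> 'm \<Rightarrow> 'm \<Rightarrow> bool" where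
  "le_cone \<sigma> m m' \<longleftrightarrow> m' - m \<in> sigma_M \<sigma>"

text \<open>
  Elements of \<open>\<int>^\<sigma>(1)\<close> are represented as integer valued functions on sets of vectors that vanish
  off \<open>\<sigma>(1)\<close>; since \<open>\<sigma>(1)\<close> is finite, all of them have finite support.
\<close>

type_synonym 'm ray_index = "'m N_real set \<Rightarrow>\<^sub>0 int"

definition Z_rays :: "'m::ab_group_add N_real set \<Rightarrow> 'm ray_index set" where
  "Z_rays \<sigma> = {c. Poly_Mapping.keys c \<subseteq> rays \<sigma>}"

definition N_rays :: "'m::ab_group_add N_real set \<Rightarrow> 'm ray_index set" where
  "N_rays \<sigma> = {c \<in> Z_rays \<sigma>. \<forall>\<rho>. 0 \<le> Poly_Mapping.lookup c \<rho>}"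

text \<open>The values of primitive vectors on \<open>M\<close> are integers that are typed as reals.\<close>

definition U_set :: "'m::ab_group_add N_real set \<Rightarrow> 'm ray_index \<Rightarrow> 'm set" where
  "U_set \<sigma> c =
     {m. \<forall>\<rho>\<in>rays \<sigma>. real_of_int (Poly_Mapping.lookup c \<rho>) \<le> pairing (primitive_vector \<rho>) m}"


section \<open>Monoid algebras and graded modules\<close>

text \<open>
  For a submonoid \<open>A\<close> of an abelian group \<open>'g\<close>, the monoid algebra \<open>K[A]\<close> is the subring of the
  group algebra \<open>'g \<Rightarrow>\<^sub>0 'k\<close> spanned by the elements \<open>\<chi>(a)\<close>, \<open>a \<in> A\<close>. Multiplication in
  \<open>'g \<Rightarrow>\<^sub>0 'k\<close> is the convolution product.
\<close>

definition chi :: "'g \<Rightarrow> 'g \<Rightarrow>\<^sub>0 'k::field" where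
  "chi g = Poly_Mapping.single g 1"

definition monoid_algebra :: "'g::ab_group_add set \<Rightarrow> ('g \<Rightarrow>\<^sub>0 'k::field) ring" where
  "monoid_algebra A = ring_of_type_algebra\<lparr>carrier := {f. Poly_Mapping.keys f \<subseteq> A}\<rparr>"

record ('r, 'e, 'g) graded_module = "('r, 'e) module" +
  hcomp :: "'g \<Rightarrow> 'e set"

text \<open>
  \<open>E\<close> is a module over \<open>K[A]\<close>, graded by the subgroup \<open>D\<close> of \<open>'g\<close> with homogeneous components
  \<open>hcomp E g\<close>, \<open>g \<in> D\<close>. Note that \<open>\<chi>(a)\<close> has degree \<open>a\<close>.
\<close>

definition is_graded_module ::
    "'g::ab_group_add set \<Rightarrow> 'g set \<Rightarrow> ('g \<Rightarrow>\<^sub>0 'k::field, 'e, 'g) graded_module \<Rightarrow> bool" where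
  "is_graded_module A D E \<longleftrightarrow>
     module (monoid_algebra A) E \<and>
     (\<forall>g\<in>D. additive_subgroup (hcomp E g) E) \<and>
     (\<forall>x\<in>carrier E. \<exists>!\<xi>. \<xi> \<in> (\<Pi>\<^sub>E g\<in>D. hcomp E g) \<and> finite {g\<in>D. \<xi> g \<noteq> \<zero>\<^bsub>E\<^esub>} \<and>
        x = finsum E \<xi> {g\<in>D. \<xi> g \<noteq> \<zero>\<^bsub>E\<^esub>}) \<and>
     (\<forall>a\<in>A. \<forall>g\<in>D. \<forall>k. \<forall>x\<in>hcomp E g. Poly_Mapping.single a k \<odot>\<^bsub>E\<^esub> x \<in> hcomp E (a + g))"

text \<open>Homomorphisms are taken extensional, so that a homomorphism is determined by its values.\<close>

definition module_hom ::
    "('r, 'b) ring_scheme \<Rightarrow> ('r, 'e, 'p) module_scheme \<Rightarrow> ('r, 'f, 'q) module_scheme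
      \<Rightarrow> ('e \<Rightarrow> 'f) set" where
  "module_hom R E F =
     {f \<in> carrier E \<rightarrow>\<^sub>E carrier F.
        (\<forall>x\<in>carrier E. \<forall>y\<in>carrier E. f (x \<oplus>\<^bsub>E\<^esub> y) = f x \<oplus>\<^bsub>F\<^esub> f y) \<and>
        (\<forall>r\<in>carrier R. \<forall>x\<in>carrier E. f (r \<odot>\<^bsub>E\<^esub> x) = r \<odot>\<^bsub>F\<^esub> f x)}"

definition is_module_iso ::
    "('r, 'b) ring_scheme \<Rightarrow> ('r, 'e, 'p) module_scheme \<Rightarrow> ('r, 'f, 'q) module_scheme
      \<Rightarrow> ('e \<Rightarrow> 'f) \<Rightarrow> bool" where
  "is_module_iso R E F f \<longleftrightarrow> module R E \<and> module R F \<and>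
     f \<in> module_hom R E F \<and> bij_betw f (carrier E) (carrier F)"

definition graded_hom ::
    "'g::ab_group_add set \<Rightarrow> 'g set \<Rightarrow> ('g \<Rightarrow>\<^sub>0 'k::field, 'e, 'g) graded_module
      \<Rightarrow> ('g \<Rightarrow>\<^sub>0 'k, 'f, 'g) graded_module \<Rightarrow> ('e \<Rightarrow> 'f) set" where
  "graded_hom A D E F =
     {f \<in> module_hom (monoid_algebra A) E F. \<forall>g\<in>D. f ` hcomp E g \<subseteq> hcomp F g}"

definition is_graded_iso ::
    "'g::ab_group_add set \<Rightarrow> 'g set \<Rightarrow> ('g \<Rightarrow>\<^sub>0 'k::field, 'e, 'g) graded_module
      \<Rightarrow> ('g \<Rightarrow>\<^sub>0 'k, 'f, 'g) graded_module \<Rightarrow> ('e \<Rightarrow> 'f) \<Rightarrow> bool" where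
  "is_graded_iso A D E F f \<longleftrightarrow> is_graded_module A D E \<and> is_graded_module A D F \<and>
     f \<in> graded_hom A D E F \<and> bij_betw f (carrier E) (carrier F) \<and>
     (\<forall>g\<in>D. f ` hcomp E g = hcomp F g)"

text \<open>
  A set \<open>C\<close> of extensional functions on \<open>I\<close> with values in a \<open>K[A]\<close>-module \<open>E\<close>, with the pointwise
  operations, as a \<open>K\<close>-vector space; \<open>K\<close> acts on \<open>E\<close> through the constants \<open>k \<chi>(0)\<close>. The fields
  \<open>mult\<close> and \<open>one\<close> of a module record carry no meaning.
\<close>

definition function_space ::
    "'i set \<Rightarrow> ('i \<Rightarrow> 'e) set \<Rightarrow> ('g::ab_group_add \<Rightarrow>\<^sub>0 'k::field, 'e, 'p) module_scheme
      \<Rightarrow> ('k, 'i \<Rightarrow> 'e) module" where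
  "function_space I C E =
     \<lparr>carrier = C, mult = undefined, one = undefined,
      zero = (\<lambda>i\<in>I. \<zero>\<^bsub>E\<^esub>), add = (\<lambda>x y. \<lambda>i\<in>I. x i \<oplus>\<^bsub>E\<^esub> y i),
      smult = (\<lambda>k x. \<lambda>i\<in>I. Poly_Mapping.single 0 k \<odot>\<^bsub>E\<^esub> x i)\<rparr>"

text \<open>
  The direct sum of the \<open>K\<close>-vector spaces \<open>V c\<close>, \<open>c \<in> D\<close>, where \<open>\<chi>(a)\<close> acts as the map
  \<open>t c (c + a) : V c \<rightarrow> V (c + a)\<close>.
\<close>

definition direct_sum_module ::
    "'g::ab_group_add set \<Rightarrow> ('g \<Rightarrow> ('k::field, 'v) module) \<Rightarrow> ('g \<Rightarrow> 'g \<Rightarrow> 'v \<Rightarrow> 'v)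
      \<Rightarrow> ('g \<Rightarrow>\<^sub>0 'k, 'g \<Rightarrow> 'v, 'g) graded_module" where
  "direct_sum_module D V t =
     (let C = {x \<in> \<Pi>\<^sub>E c\<in>D. carrier (V c). finite {c\<in>D. x c \<noteq> \<zero>\<^bsub>V c\<^esub>}} in
      \<lparr>carrier = C, mult = undefined, one = undefined,
       zero = (\<lambda>c\<in>D. \<zero>\<^bsub>V c\<^esub>), add = (\<lambda>x y. \<lambda>c\<in>D. x c \<oplus>\<^bsub>V c\<^esub> y c),
       smult = (\<lambda>f x. \<lambda>c\<in>D. finsum (V c)
          (\<lambda>a. Poly_Mapping.lookup f a \<odot>\<^bsub>V c\<^esub> t (c - a) c (x (c - a))) (Poly_Mapping.keys f)),
       hcomp = (\<lambda>c. {x \<in> C. \<forall>c'\<in>D - {c}. x c' = \<zero>\<^bsub>V c'\<^esub>})\<rparr>)"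


section \<open>The lifting\<close>

text \<open>
  \<open>S\<^sub>(\<^sub>c\<^sub>)\<close>, spanned by the \<open>\<chi>(m)\<close> with \<open>l\<^sub>\<rho>(m) \<ge> - c\<^sub>\<rho>\<close> for all rays \<open>\<rho>\<close>, as a submodule of \<open>K[M]\<close>.
\<close>

definition S_shift ::
    "'m::ab_group_add N_real set \<Rightarrow> 'm ray_index
      \<Rightarrow> ('m \<Rightarrow>\<^sub>0 'k::field, 'm \<Rightarrow>\<^sub>0 'k, 'm) graded_module" where
  "S_shift \<sigma> c =
     (let W = {m. \<forall>\<rho>\<in>rays \<sigma>.
                 pairing (primitive_vector \<rho>) m \<ge> - real_of_int (Poly_Mapping.lookup c \<rho>)} in
      \<lparr>carrier = {f. Poly_Mapping.keys f \<subseteq> W}, mult = undefined, one = undefined,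
       zero = 0, add = (+), smult = (*),
       hcomp = (\<lambda>m. {f. Poly_Mapping.keys f \<subseteq> W \<inter> {m}})\<rparr>)"

definition lifting_component ::
    "'m::ab_group_add N_real set \<Rightarrow> ('m \<Rightarrow>\<^sub>0 'k::field, 'e, 'm) graded_module \<Rightarrow> 'm ray_index
      \<Rightarrow> ('k, ('m \<Rightarrow>\<^sub>0 'k) \<Rightarrow> 'e) module" where
  "lifting_component \<sigma> E c =
     function_space (carrier (S_shift \<sigma> (- c)))
       (graded_hom (sigma_M \<sigma>) UNIV (S_shift \<sigma> (- c)) E) E"

definition lifting ::
    "'m::ab_group_add N_real set \<Rightarrow> ('m \<Rightarrow>\<^sub>0 'k::field, 'e, 'm) graded_module
      \<Rightarrow> ('m ray_index \<Rightarrow>\<^sub>0 'k, 'm ray_index \<Rightarrow> ('m \<Rightarrow>\<^sub>0 'k) \<Rightarrow> 'e, 'm ray_index) graded_module"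
  where
  "lifting \<sigma> E =
     direct_sum_module (Z_rays \<sigma>) (lifting_component \<sigma> E)
       (\<lambda>c c' \<phi>. restrict \<phi> (carrier (S_shift \<sigma> (- c'))))"

definition lifting_component_map ::
    "'m::ab_group_add N_real set \<Rightarrow> ('e \<Rightarrow> 'f) \<Rightarrow> 'm ray_index
      \<Rightarrow> (('m \<Rightarrow>\<^sub>0 'k::field) \<Rightarrow> 'e) \<Rightarrow> ('m \<Rightarrow>\<^sub>0 'k) \<Rightarrow> 'f" where
  "lifting_component_map \<sigma> f c \<phi> = compose (carrier (S_shift \<sigma> (- c))) f \<phi>"

definition lifting_map ::
    "'m::ab_group_add N_real set \<Rightarrow> ('e \<Rightarrow> 'f)
      \<Rightarrow> ('m ray_index \<Rightarrow> ('m \<Rightarrow>\<^sub>0 'k::field) \<Rightarrow> 'e)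
      \<Rightarrow> 'm ray_index \<Rightarrow> ('m \<Rightarrow>\<^sub>0 'k) \<Rightarrow> 'f" where
  "lifting_map \<sigma> f x = (\<lambda>c\<in>Z_rays \<sigma>. lifting_component_map \<sigma> f c (x c))"


section \<open>The module of limits\<close>

text \<open>
  The transition map \<open>E\<^sub>m \<rightarrow> E\<^sub>m\<^sub>'\<close> of the functor given by \<open>E\<close> is multiplication by \<open>\<chi>(m' - m)\<close>;
  the limit over \<open>U\<^sub>c\<close> is realised by the compatible families.
\<close>

definition limit_component ::
    "'m::ab_group_add N_real set \<Rightarrow> ('m \<Rightarrow>\<^sub>0 'k::field, 'e, 'm) graded_module \<Rightarrow> 'm ray_index
      \<Rightarrow> ('k, 'm \<Rightarrow> 'e) module" where
  "limit_component \<sigma> E c =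
     function_space (U_set \<sigma> c)
       {x \<in> \<Pi>\<^sub>E m\<in>U_set \<sigma> c. hcomp E m.
          \<forall>m\<in>U_set \<sigma> c. \<forall>m'\<in>U_set \<sigma> c. le_cone \<sigma> m m' \<longrightarrow> chi (m' - m) \<odot>\<^bsub>E\<^esub> x m = x m'} E"

definition limit_module ::
    "'m::ab_group_add N_real set \<Rightarrow> ('m \<Rightarrow>\<^sub>0 'k::field, 'e, 'm) graded_module
      \<Rightarrow> ('m ray_index \<Rightarrow>\<^sub>0 'k, 'm ray_index \<Rightarrow> 'm \<Rightarrow> 'e, 'm ray_index) graded_module" where
  "limit_module \<sigma> E =
     direct_sum_module (Z_rays \<sigma>) (limit_component \<sigma> E) (\<lambda>c c' x. restrict x (U_set \<sigma> c'))"

definition limit_component_map ::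
    "'m::ab_group_add N_real set \<Rightarrow> ('e \<Rightarrow> 'f) \<Rightarrow> 'm ray_index \<Rightarrow> ('m \<Rightarrow> 'e) \<Rightarrow> 'm \<Rightarrow> 'f" where
  "limit_component_map \<sigma> f c x = compose (U_set \<sigma> c) f x"

definition limit_map ::
    "'m::ab_group_add N_real set \<Rightarrow> ('e \<Rightarrow> 'f) \<Rightarrow> ('m ray_index \<Rightarrow> 'm \<Rightarrow> 'e)
      \<Rightarrow> 'm ray_index \<Rightarrow> 'm \<Rightarrow> 'f" where
  "limit_map \<sigma> f x = (\<lambda>c\<in>Z_rays \<sigma>. limit_component_map \<sigma> f c (x c))"

end

theory Submission
  imports Defs
begin

text \<open>
  A degree preserving homomorphism \<open>\<psi>\<close> from \<open>S\<^sub>(\<^sub>-\<^sub>c\<^sub>)\<close> to \<open>E\<close> is determined by the elements \<open>\<psi>(\<chi>(m))\<close>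
  of \<open>E\<^sub>m\<close> with \<open>m \<in> U\<^sub>c\<close>, because the \<open>\<chi>(m)\<close> form a basis of \<open>S\<^sub>(\<^sub>-\<^sub>c\<^sub>)\<close>. Since
  \<open>\<chi>(a) \<chi>(m) = \<chi>(a + m)\<close> for \<open>a \<in> \<sigma>\<^sub>M\<close>, the homomorphism being \<open>K[\<sigma>\<^sub>M]\<close>-linear means exactly that
  these elements are compatible with the transition maps of \<open>E\<close>, that is, that they form a point of the
  limit over \<open>U\<^sub>c\<close>. Evaluation at the characters is therefore an isomorphism
  (\<open>evaluation_iso\<close>), whose inverse extends a compatible family linearly (\<open>linear_extension\<close>). It
  commutes with restriction to a smaller \<open>U\<^sub>c\<close>, which is how the monomials of \<open>S\<close> act on both sides, and
  with homomorphisms \<open>E \<rightarrow> E'\<close> (\<open>evaluation_natural\<close>).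

  The geometry of the cone enters through \<open>\<sigma>\<^sub>M + U\<^sub>c \<subseteq> U\<^sub>c\<close> (\<open>U_set_sigma_M\<close>), without which \<open>S\<^sub>(\<^sub>-\<^sub>c\<^sub>)\<close> would not be a
  module over \<open>K[\<sigma>\<^sub>M]\<close>. This holds because the primitive vector of a ray of \<open>\<sigma>\<close> exists and lies in
  \<open>\<sigma>\<close> (\<open>primitive_vector_in_ray\<close>): a one-dimensional face of a strictly convex cone is a half-line, the
  half-line contains one of the lattice vectors that generate \<open>\<sigma>\<close>, and the lattice points on it are
  then the natural multiples of the shortest nonzero one.

  The remaining work is formal: that the direct sum of a system of vector spaces indexed by \<open>\<int>\<^sup>\<sigma>\<^sup>(\<^sup>1\<^sup>)\<close>, with
  transition maps along \<open>\<nat>\<^sup>\<sigma>\<^sup>(\<^sup>1\<^sup>)\<close>, is a graded \<open>S\<close>-module (\<open>is_graded_module_M\<close>), and that an isomorphism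
  of such systems induces a graded isomorphism of the sums (\<open>direct_sum_graded_iso\<close>).
\<close>


section \<open>Rays and their primitive vectors\<close>

lemma pairing_scaleR [simp]: "pairing (r *\<^sub>R v) m = r * pairing v m"
  by transfer simp

lemma pairing_zero [simp]: "pairing 0 m = 0"
  by transfer simp

lemma pairing_add_right: "pairing v (m + m') = pairing v m + pairing v m'"
  by transfer simp

lemma pairing_zero_right [simp]: "pairing v 0 = 0"
  using pairing_add_right[of v 0 0] by simp

text \<open>
  If \<open>x \<noteq> y\<close>, then \<open>x + y\<close> is the midpoint of \<open>2x\<close> and \<open>2y\<close>, so the face contains both of them. From
  \<open>2z\<close> one gets to \<open>z\<close> because \<open>2z\<close> is the midpoint of \<open>z\<close> and \<open>3z\<close>.
\<close>

lemma face_of_convex_cone_add: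
  assumes cone: "convex_cone S" and F: "F face_of S"
    and x: "x \<in> S" and y: "y \<in> S" and xy: "x + y \<in> F"
  shows "x \<in> F" "y \<in> F"
proof -
  have x2: "2 *\<^sub>R x \<in> S" and y2: "2 *\<^sub>R y \<in> S"
    using convex_cone_add[OF cone x x] convex_cone_add[OF cone y y] by (simp_all add: scaleR_2)
  have s2: "2 *\<^sub>R (x + y) \<in> S" and s: "x + y \<in> S"
    using convex_cone_add[OF cone x2 y2] convex_cone_add[OF cone x y] by (simp_all add: scaleR_add_right)
  have scale: "z \<in> F" if "2 *\<^sub>R z \<in> F" "z \<in> S" for z
  proof (cases "z = 0")
    case True
    then show ?thesis using that by simp
  next
    case False
    have "3 *\<^sub>R z \<in> S"
      using convex_cone_scaleR[OF cone, of 3 z] that(2) by simp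
    moreover have "2 *\<^sub>R z \<in> open_segment z (3 *\<^sub>R z)"
      unfolding in_segment
    proof (intro conjI exI[of _ "1/2 :: real"])
      show "z \<noteq> 3 *\<^sub>R z"
        using False scaleR_cancel_right[of 1 z 3] by simp
      show "2 *\<^sub>R z = (1 - 1 / 2) *\<^sub>R z + (1 / 2) *\<^sub>R 3 *\<^sub>R z"
        by (simp add: scaleR_left_distrib[symmetric])
    qed auto
    ultimately show ?thesis using face_ofD[OF F, of "2 *\<^sub>R z" z "3 *\<^sub>R z"] that by simp
  qed
  have "x \<in> F \<and> y \<in> F"
  proof (cases "x = y")
    case True
    then show ?thesis using scale[of x] xy x by (simp add: scaleR_2)
  next
    case False
    have "x + y \<in> open_segment (2 *\<^sub>R x) (2 *\<^sub>R y)"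
      unfolding in_segment
    proof (intro conjI exI[of _ "1/2 :: real"])
      show "2 *\<^sub>R x \<noteq> 2 *\<^sub>R y" using False by simp
      show "x + y = (1 - 1 / 2) *\<^sub>R 2 *\<^sub>R x + (1 / 2) *\<^sub>R 2 *\<^sub>R y" by simp
    qed auto
    then have "2 *\<^sub>R x \<in> F" "2 *\<^sub>R y \<in> F" using face_ofD[OF F _ x2 y2 xy] by auto
    then show ?thesis using scale x y by simp
  qed
  then show "x \<in> F" "y \<in> F" by auto
qed

lemma face_of_convex_cone_scaleR:
  assumes cone: "convex_cone S" and F: "F face_of S" and x: "x \<in> F" and r: "0 \<le> r"
  shows "r *\<^sub>R x \<in> F"
proof -
  have sub: "F \<subseteq> S" using F by (simp add: face_of_imp_subset)
  have conic: "t *\<^sub>R x \<in> S" if "0 \<le> t" for t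
    using convex_cone_scaleR[OF cone that] sub x by blast
  have small: "t *\<^sub>R x \<in> F" if "0 \<le> t" "t \<le> 1" for t
    using face_of_convex_cone_add(1)[OF cone F conic[of t] conic[of "1 - t"]] that x
    by (simp add: scaleR_left_distrib[symmetric])
  show ?thesis
  proof (cases "r \<le> 1")
    case True
    then show ?thesis using small r by blast
  next
    case False
    show ?thesis
    proof (cases "x = 0")
      case True
      then show ?thesis using x by simp
    next
      case x0: False
      have "x \<in> open_segment 0 (r *\<^sub>R x)"
        unfolding in_segment
      proof (intro conjI exI[of _ "1 / r"])
        show "0 \<noteq> r *\<^sub>R x" using x0 False r by simp
        show "x = (1 - 1 / r) *\<^sub>R 0 + (1 / r) *\<^sub>R r *\<^sub>R x" using False by simp
      qed (use False in auto)
      then show ?thesis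
        using face_ofD[OF F _ _ conic[OF r] x] conic[of 0] by simp
    qed
  qed
qed

text \<open>
  Otherwise the points of the cone that are \<open>0\<close> or not in the face form a convex cone containing all
  generators, hence they are the whole cone.
\<close>

lemma face_of_convex_cone_hull_generator:
  assumes F: "F face_of (convex_cone hull G)" and v: "v \<in> F" "v \<noteq> 0"
  obtains g where "g \<in> G" "g \<in> F" "g \<noteq> 0"
proof -
  let ?S = "convex_cone hull G"
  let ?T = "{x \<in> ?S. x \<in> F \<longrightarrow> x = 0}"
  have cone: "convex_cone ?S" by (rule convex_cone_convex_cone_hull)
  have "\<exists>g\<in>G. g \<in> F \<and> g \<noteq> 0"
  proof (rule ccontr)
    assume no: "\<not> ?thesis"
    have conicT: "r *\<^sub>R x \<in> ?T" if x: "x \<in> ?T" and r: "0 \<le> r" for x r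
    proof -
      have "r *\<^sub>R x = 0" if rx: "r *\<^sub>R x \<in> F"
      proof (rule ccontr)
        assume nz: "r *\<^sub>R x \<noteq> 0"
        then have "(1 / r) *\<^sub>R r *\<^sub>R x \<in> F"
          using face_of_convex_cone_scaleR[OF cone F rx, of "1 / r"] r by simp
        then show False using nz x by simp
      qed
      then show ?thesis using x r by (auto simp: convex_cone_hull_mul)
    qed
    have addT: "x + y \<in> ?T" if x: "x \<in> ?T" and y: "y \<in> ?T" for x y
      using face_of_convex_cone_add[OF cone F, of x y] x y by (auto simp: convex_cone_hull_add)
    have "convex_cone ?T"
      by (rule convex_cone_iff[THEN iffD2], intro conjI ballI allI impI conicT addT)
        (simp_all add: convex_cone_hull_contains_0)
    moreover have "G \<subseteq> ?T" using no by (auto simp: hull_inc)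
    ultimately have "?S \<subseteq> ?T" by (rule hull_minimal[rotated])
    then show False using v face_of_imp_subset[OF F] by blast
  qed
  then show ?thesis using that by blast
qed

text \<open>
  A one-dimensional face lies on the line through a generator \<open>g\<close> that it contains. Strict convexity
  excludes the negative half of the line, since \<open>-g\<close> would also be in the cone.
\<close>

lemma ray_generated_by_lattice_vector:
  fixes \<sigma> :: "'m::ab_group_add N_real set"
  assumes "rational_polyhedral_cone \<sigma>" and sc: "strictly_convex_cone \<sigma>" and \<rho>: "\<rho> \<in> rays \<sigma>"
  obtains g where "g \<in> N_lattice" "g \<noteq> 0" "\<rho> = {t *\<^sub>R g | t. 0 \<le> t}"
proof -
  obtain G where G: "G \<subseteq> N_lattice" "\<sigma> = convex_cone hull G"
    using assms unfolding rational_polyhedral_cone_def by blast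
  have cone: "convex_cone \<sigma>" unfolding G by (rule convex_cone_convex_cone_hull)
  have F: "\<rho> face_of \<sigma>" and dim: "dim \<rho> = 1" using \<rho> by (auto simp: rays_def)
  obtain B where B: "B \<subseteq> \<rho>" "independent B" "\<rho> \<subseteq> span B" "card B = dim \<rho>"
    by (rule basis_exists)
  obtain v where v: "B = {v}" using B(4) dim by (auto simp: card_1_singleton_iff)
  have "v \<noteq> 0" using B(2) v by auto
  with B(1) v obtain g where g: "g \<in> G" "g \<in> \<rho>" "g \<noteq> 0"
    using face_of_convex_cone_hull_generator[of \<rho> G v] F G(2) by auto
  have "x \<in> {t *\<^sub>R g | t. 0 \<le> t}" if x: "x \<in> \<rho>" for x
  proof -
    obtain s where s: "g = s *\<^sub>R v" using B(3) v g(2) by (auto simp: span_singleton)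
    obtain r where r: "x = r *\<^sub>R v" using B(3) v x by (auto simp: span_singleton)
    have s0: "s \<noteq> 0" using s g(3) by auto
    have xg: "x = (r / s) *\<^sub>R g" using s r s0 by simp
    have "0 \<le> r / s"
    proof (rule ccontr)
      assume neg: "\<not> 0 \<le> r / s"
      then have "0 \<le> - (s / r)" by (auto simp: zero_le_divide_iff divide_le_0_iff)
      then have "(- (s / r)) *\<^sub>R x \<in> \<sigma>"
        using face_of_convex_cone_scaleR[OF cone F x, of "- (s / r)"] face_of_imp_subset[OF F]
        by blast
      moreover have "(- (s / r)) *\<^sub>R x = - g" using neg s0 unfolding xg by auto
      ultimately have "- g \<in> \<sigma>" by simp
      moreover have "g \<in> \<sigma>" using g(2) face_of_imp_subset[OF F] by blast
      ultimately have "g \<in> \<sigma> \<inter> uminus ` \<sigma>" by (auto intro: image_eqI[of _ _ "- g"])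
      then show False using sc g(3) unfolding strictly_convex_cone_def by blast
    qed
    then show ?thesis using xg by blast
  qed
  moreover have "t *\<^sub>R g \<in> \<rho>" if "0 \<le> t" for t
    by (rule face_of_convex_cone_scaleR[OF cone F g(2) that])
  ultimately have "\<rho> = {t *\<^sub>R g | t. 0 \<le> t}" by blast
  with g G(1) that show ?thesis by blast
qed

text \<open>
  Applied to the set of all \<open>t\<close> for which \<open>t g\<close> is a lattice vector, where \<open>z\<close> is a nonzero integral
  value of \<open>g\<close>: its nonnegative elements are fractions with denominator \<open>\<bar>z\<bar>\<close>, so there is a
  least positive one, and subtracting it repeatedly from another one must end at zero.
\<close>

lemma multiples_of_least_fraction:
  fixes T :: "real set" and z :: real
  assumes z: "z \<noteq> 0" and one: "1 \<in> T" and int: "\<And>t. t \<in> T \<Longrightarrow> t * z \<in> \<int>"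
    and diff: "\<And>s t. s \<in> T \<Longrightarrow> t \<in> T \<Longrightarrow> t \<le> s \<Longrightarrow> s - t \<in> T"
  obtains t0 where "t0 \<in> T" "0 < t0" "\<And>t. t \<in> T \<Longrightarrow> 0 \<le> t \<Longrightarrow> \<exists>k::nat. t = real k * t0"
proof -
  \<comment> \<open>The nonnegative elements of \<open>T\<close> are fractions \<open>n / \<bar>z\<bar>\<close>, so the least one is found among the numerators.\<close>
  define P where "P n \<longleftrightarrow> n > 0 \<and> real n / \<bar>z\<bar> \<in> T" for n :: nat
  have nat: "\<exists>n. t = real n / \<bar>z\<bar>" if "t \<in> T" "0 \<le> t" for t
  proof -
    have "t * \<bar>z\<bar> \<in> \<int>" using int[OF that(1)] by (auto simp: abs_if)
    moreover have "0 \<le> t * \<bar>z\<bar>" using that by simp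
    ultimately have "t * \<bar>z\<bar> \<in> \<nat>" using Nats_altdef2 by (auto simp: Nats_altdef2)
    then obtain n where "t * \<bar>z\<bar> = real n" by (auto simp: Nats_def)
    then show ?thesis using z by (intro exI[of _ n]) (simp add: field_simps)
  qed
  have "\<exists>n. P n"
  proof -
    obtain n where n: "1 = real n / \<bar>z\<bar>" using nat[OF one] by auto
    then have "P n" using one unfolding P_def by (auto intro!: Nat.gr0I)
    then show ?thesis ..
  qed
  then have P0: "P (LEAST n. P n)" by (rule LeastI_ex)
  define n0 where "n0 = (LEAST n. P n)"
  have n0: "P n0" using P0 unfolding n0_def .
  have min: "n0 \<le> n" if "P n" for n unfolding n0_def using that by (rule Least_le)
  let ?t0 = "real n0 / \<bar>z\<bar>"
  have t0: "?t0 \<in> T" "0 < ?t0" using n0 z unfolding P_def by auto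
  have "\<exists>k. t = real k * ?t0" if t: "t \<in> T" "0 \<le> t" for t
  proof -
    have "\<exists>k. real n / \<bar>z\<bar> = real k * ?t0" if "real n / \<bar>z\<bar> \<in> T" for n
      using that
    proof (induction n rule: less_induct)
      case (less n)
      show ?case
      proof (cases "n = 0")
        case True
        then show ?thesis by (intro exI[of _ 0]) simp
      next
        case False
        then have le: "n0 \<le> n" using min less.prems unfolding P_def by simp
        have eq: "real (n - n0) / \<bar>z\<bar> = real n / \<bar>z\<bar> - ?t0"
          using le by (simp add: of_nat_diff diff_divide_distrib)
        have "real (n - n0) / \<bar>z\<bar> \<in> T"
          unfolding eq using diff[OF less.prems t0(1)] le by (simp add: divide_right_mono)
        moreover have "n - n0 < n" using False n0 unfolding P_def by simp
        ultimately obtain k where "real (n - n0) / \<bar>z\<bar> = real k * ?t0"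
          using less.IH by blast
        then have "real n / \<bar>z\<bar> = real (Suc k) * ?t0"
          unfolding eq by (simp add: algebra_simps add_divide_distrib)
        then show ?thesis by blast
      qed
    qed
    then show ?thesis using nat[OF t] t by blast
  qed
  then show ?thesis using that t0 by blast
qed

text \<open>
  The definition by unique choice has a value because two vectors with the same natural multiples are
  natural multiples of each other, hence equal. The value is the shortest nonzero lattice vector on the ray.
\<close>

lemma primitive_vector_in_ray:
  fixes \<sigma> :: "'m::ab_group_add N_real set"
  assumes "rational_polyhedral_cone \<sigma>" and "strictly_convex_cone \<sigma>" and "\<rho> \<in> rays \<sigma>"
  shows "primitive_vector \<rho> \<in> \<rho>"
proof -
  obtain g where g: "g \<in> N_lattice" "g \<noteq> 0" and \<rho>: "\<rho> = {t *\<^sub>R g | t. 0 \<le> t}"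
    using ray_generated_by_lattice_vector[OF assms] .
  obtain m where m: "pairing g m \<noteq> 0"
  proof -
    have "\<exists>m. pairing g m \<noteq> 0"
    proof (rule ccontr)
      assume "\<not> ?thesis"
      then have "pairing g = pairing 0" by auto
      then show False using g(2) by (simp add: pairing_inject)
    qed
    then show ?thesis using that by blast
  qed
  let ?T = "{t. t *\<^sub>R g \<in> N_lattice}"
  obtain t0 where t0: "t0 \<in> ?T" "0 < t0" "\<And>t. t \<in> ?T \<Longrightarrow> 0 \<le> t \<Longrightarrow> \<exists>k::nat. t = real k * t0"
  proof (rule multiples_of_least_fraction[OF m, of ?T])
    show "1 \<in> ?T" using g by simp
  qed (auto simp: N_lattice_def algebra_simps)
  have lat: "\<rho> \<inter> N_lattice = range (\<lambda>k::nat. real k *\<^sub>R (t0 *\<^sub>R g))"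
  proof (intro equalityI subsetI)
    fix x assume "x \<in> \<rho> \<inter> N_lattice"
    then obtain t where "x = t *\<^sub>R g" "0 \<le> t" "t \<in> ?T" unfolding \<rho> by auto
    then show "x \<in> range (\<lambda>k::nat. real k *\<^sub>R (t0 *\<^sub>R g))" using t0(3)[of t] by force
  next
    fix x assume "x \<in> range (\<lambda>k::nat. real k *\<^sub>R (t0 *\<^sub>R g))"
    then obtain k :: nat where x: "x = real k *\<^sub>R (t0 *\<^sub>R g)" by auto
    have "pairing x m' \<in> \<int>" for m'
      unfolding x pairing_scaleR[of "real k"]
      using t0(1) unfolding N_lattice_def by (intro Ints_mult Ints_of_nat) blast
    then have "x \<in> N_lattice" unfolding N_lattice_def by blast
    moreover have "x \<in> \<rho>" unfolding \<rho> x using t0(2) by (auto intro!: exI[of _ "real k * t0"])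
    ultimately show "x \<in> \<rho> \<inter> N_lattice" by blast
  qed
  have unique: "l = l'"
    if "\<rho> \<inter> N_lattice = range (\<lambda>k::nat. real k *\<^sub>R l)" "\<rho> \<inter> N_lattice = range (\<lambda>k::nat. real k *\<^sub>R l')"
    for l l' :: "'m N_real"
  proof -
    have eq: "range (\<lambda>k::nat. real k *\<^sub>R l) = range (\<lambda>k::nat. real k *\<^sub>R l')" using that by simp
    have "real 1 *\<^sub>R l \<in> range (\<lambda>k::nat. real k *\<^sub>R l')" unfolding eq[symmetric] by blast
    then obtain j :: nat where j: "l = real j *\<^sub>R l'" by auto
    have "real 1 *\<^sub>R l' \<in> range (\<lambda>k::nat. real k *\<^sub>R l)" unfolding eq by blast
    then obtain k :: nat where k: "l' = real k *\<^sub>R l" by auto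
    have "1 *\<^sub>R l = real (j * k) *\<^sub>R l"
      using j k by (metis of_nat_mult scaleR_one scaleR_scaleR)
    then consider "l = 0" | "real (j * k) = 1"
      by (subst (asm) scaleR_cancel_right) metis
    then show ?thesis
    proof cases
      case 1
      show ?thesis using k by (simp only: 1 scaleR_zero_right)
    next
      case 2
      then have "real (j * k) = real 1" by simp
      then have "j * k = 1" by (simp only: of_nat_eq_iff)
      then have "j = 1" by simp
      show ?thesis using j by (simp only: \<open>j = 1\<close> of_nat_1 scaleR_one)
    qed
  qed
  have "primitive_vector \<rho> = t0 *\<^sub>R g"
    unfolding primitive_vector_def
  proof (rule the_equality)
    show "\<rho> \<inter> N_lattice = range (\<lambda>k::nat. real k *\<^sub>R (t0 *\<^sub>R g))" by (rule lat)
    show "l = t0 *\<^sub>R g" if "\<rho> \<inter> N_lattice = range (\<lambda>k::nat. real k *\<^sub>R l)" for l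
      by (rule unique[OF that lat])
  qed
  then show ?thesis unfolding \<rho> using t0(2) by auto
qed

lemma sigma_M_zero: "0 \<in> sigma_M \<sigma>"
  by (simp add: sigma_M_def)

text \<open>
  Elements of \<open>\<sigma>\<^sub>M\<close> are nonnegative on primitive vectors because these lie in \<open>\<sigma>\<close>.
\<close>

lemma U_set_sigma_M:
  assumes "rational_polyhedral_cone \<sigma>" and "strictly_convex_cone \<sigma>"
    and "a \<in> sigma_M \<sigma>" and "m \<in> U_set \<sigma> c"
  shows "a + m \<in> U_set \<sigma> c"
  unfolding U_set_def
proof (intro CollectI ballI)
  fix \<rho> assume \<rho>: "\<rho> \<in> rays \<sigma>"
  then have "\<rho> \<subseteq> \<sigma>" unfolding rays_def using face_of_imp_subset by blast
  then have "primitive_vector \<rho> \<in> \<sigma>"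
    using primitive_vector_in_ray[OF assms(1,2) \<rho>] by blast
  then have "0 \<le> pairing (primitive_vector \<rho>) a"
    using assms(3) unfolding sigma_M_def by blast
  moreover have "real_of_int (Poly_Mapping.lookup c \<rho>) \<le> pairing (primitive_vector \<rho>) m"
    using assms(4) \<rho> unfolding U_set_def by blast
  ultimately show "real_of_int (Poly_Mapping.lookup c \<rho>) \<le> pairing (primitive_vector \<rho>) (a + m)"
    by (simp add: pairing_add_right)
qed

section \<open>Monoid algebras\<close>

lemma ring_of_type_algebra_simps [simp]:
  "carrier (ring_of_type_algebra :: 'a::ring_1 ring) = UNIV"
  "x \<oplus>\<^bsub>ring_of_type_algebra\<^esub> y = x + (y :: 'a)"
  "x \<otimes>\<^bsub>ring_of_type_algebra\<^esub> y = x * (y :: 'a)"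
  "\<zero>\<^bsub>ring_of_type_algebra\<^esub> = (0 :: 'a)"
  "\<one>\<^bsub>ring_of_type_algebra\<^esub> = (1 :: 'a)"
  by (simp_all add: ring_of_type_algebra_def)

lemma monoid_algebra_simps [simp]:
  "carrier (monoid_algebra A) = {f :: 'g::ab_group_add \<Rightarrow>\<^sub>0 'k::field. Poly_Mapping.keys f \<subseteq> A}"
  "x \<oplus>\<^bsub>monoid_algebra A\<^esub> y = x + (y :: 'g \<Rightarrow>\<^sub>0 'k)"
  "x \<otimes>\<^bsub>monoid_algebra A\<^esub> y = x * (y :: 'g \<Rightarrow>\<^sub>0 'k)"
  "\<zero>\<^bsub>monoid_algebra A\<^esub> = (0 :: 'g \<Rightarrow>\<^sub>0 'k)"
  "\<one>\<^bsub>monoid_algebra A\<^esub> = (1 :: 'g \<Rightarrow>\<^sub>0 'k)"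
  by (simp_all add: monoid_algebra_def ring_of_type_algebra_def)

lemma cring_monoid_algebra:
  assumes "0 \<in> A" and add: "\<And>a b. a \<in> A \<Longrightarrow> b \<in> A \<Longrightarrow> a + b \<in> A"
  shows "cring (monoid_algebra A :: ('g::ab_group_add \<Rightarrow>\<^sub>0 'k::field) ring)"
proof (rule cringI)
  show "abelian_group (monoid_algebra A :: ('g \<Rightarrow>\<^sub>0 'k) ring)"
  proof (rule abelian_groupI)
    fix x :: "'g \<Rightarrow>\<^sub>0 'k" assume "x \<in> carrier (monoid_algebra A)"
    then show "\<exists>y\<in>carrier (monoid_algebra A). y \<oplus>\<^bsub>monoid_algebra A\<^esub> x = \<zero>\<^bsub>monoid_algebra A\<^esub>"
      by (intro bexI[of _ "- x"]) auto
  next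
    fix x y :: "'g \<Rightarrow>\<^sub>0 'k" assume "x \<in> carrier (monoid_algebra A)" "y \<in> carrier (monoid_algebra A)"
    then show "x \<oplus>\<^bsub>monoid_algebra A\<^esub> y \<in> carrier (monoid_algebra A)"
      using keys_add[of x y] by auto
  qed (simp_all add: algebra_simps)
  show "comm_monoid (monoid_algebra A :: ('g \<Rightarrow>\<^sub>0 'k) ring)"
  proof (rule comm_monoidI)
    fix x y :: "'g \<Rightarrow>\<^sub>0 'k" assume "x \<in> carrier (monoid_algebra A)" "y \<in> carrier (monoid_algebra A)"
    then show "x \<otimes>\<^bsub>monoid_algebra A\<^esub> y \<in> carrier (monoid_algebra A)"
      using keys_mult[of x y] add by fastforce
  next
    show "\<one>\<^bsub>monoid_algebra A\<^esub> \<in> carrier (monoid_algebra A :: ('g \<Rightarrow>\<^sub>0 'k) ring)"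
      using assms(1) by (simp flip: single_one)
  qed (simp_all add: algebra_simps)
qed (simp add: algebra_simps)

text \<open>
  Induction along the basis of monomials with exponents in \<open>A\<close>; it reduces identities that are additive
  in an element of a monoid algebra to monomials.
\<close>

lemma poly_mapping_on_induct [consumes 1, case_names zero single add]:
  assumes "Poly_Mapping.keys f \<subseteq> A" and "P 0" and single: "\<And>a k. a \<in> A \<Longrightarrow> P (Poly_Mapping.single a k)"
    and add: "\<And>f g. Poly_Mapping.keys f \<subseteq> A \<Longrightarrow> Poly_Mapping.keys g \<subseteq> A \<Longrightarrow> P f \<Longrightarrow> P g \<Longrightarrow> P (f + g)"
  shows "P f"
  using assms(1)
proof (induction f rule: update_induct)
  case const
  show ?case by (rule \<open>P 0\<close>)
next
  case (update f a b)
  have eq: "Poly_Mapping.update a b f = Poly_Mapping.single a b + f"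
    using update.hyps(1)
    by (intro poly_mapping_eqI) (auto simp: lookup_update lookup_add lookup_single in_keys_iff when_def)
  have keys: "Poly_Mapping.keys (Poly_Mapping.update a b f) = insert a (Poly_Mapping.keys f)"
    using update.hyps by (auto simp: in_keys_iff lookup_update split: if_splits)
  then show ?case
    using update.prems update.IH unfolding keys unfolding eq by (intro add single) auto
qed

lemma (in abelian_monoid) finsum_mono_neutral:
  assumes "finite T" "S \<subseteq> T" "f \<in> T \<rightarrow> carrier G" "\<And>i. i \<in> T - S \<Longrightarrow> f i = \<zero>"
  shows "finsum G f S = finsum G f T"
proof -
  have "finsum G f (S \<union> (T - S)) = finsum G f S \<oplus> finsum G f (T - S)"
    using assms by (intro finsum_Un_disjoint) (auto intro: finite_subset)
  moreover have "finsum G f (T - S) = \<zero>"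
    using assms(4) by (intro add.finprod_one_eqI) auto
  moreover have "S \<union> (T - S) = T" using assms(2) by blast
  moreover have "finsum G f S \<in> carrier G" using assms(2,3) by (intro finsum_closed) auto
  ultimately show ?thesis by simp
qed

section \<open>Direct sums of systems of vector spaces\<close>

text \<open>
  A functor from the group \<open>D\<close>, preordered by \<open>c \<le> a + c\<close> for \<open>a\<close> in the submonoid \<open>A\<close>, to vector
  spaces. Only the values of \<open>t c c'\<close> with \<open>c \<le> c'\<close> are constrained. Both the lifting and the module of
  limits are direct sums of such functors.
\<close>

locale graded_system =
  fixes A D :: "'g::ab_group_add set" and V :: "'g \<Rightarrow> ('k::field, 'v) module"
    and t :: "'g \<Rightarrow> 'g \<Rightarrow> 'v \<Rightarrow> 'v"
  assumes A_zero: "0 \<in> A" and A_add: "a \<in> A \<Longrightarrow> b \<in> A \<Longrightarrow> a + b \<in> A"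
    and A_sub_D: "A \<subseteq> D" and D_diff: "c \<in> D \<Longrightarrow> c' \<in> D \<Longrightarrow> c - c' \<in> D"
    and module_V: "c \<in> D \<Longrightarrow> module ring_of_type_algebra (V c)"
    and t_closed: "c \<in> D \<Longrightarrow> a \<in> A \<Longrightarrow> x \<in> carrier (V c) \<Longrightarrow> t c (a + c) x \<in> carrier (V (a + c))"
    and t_add: "c \<in> D \<Longrightarrow> a \<in> A \<Longrightarrow> x \<in> carrier (V c) \<Longrightarrow> y \<in> carrier (V c) \<Longrightarrow>
      t c (a + c) (x \<oplus>\<^bsub>V c\<^esub> y) = t c (a + c) x \<oplus>\<^bsub>V (a + c)\<^esub> t c (a + c) y"
    and t_smult: "c \<in> D \<Longrightarrow> a \<in> A \<Longrightarrow> x \<in> carrier (V c) \<Longrightarrow>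
      t c (a + c) (k \<odot>\<^bsub>V c\<^esub> x) = k \<odot>\<^bsub>V (a + c)\<^esub> t c (a + c) x"
    and t_id: "c \<in> D \<Longrightarrow> x \<in> carrier (V c) \<Longrightarrow> t c c x = x"
    and t_comp: "c \<in> D \<Longrightarrow> a \<in> A \<Longrightarrow> b \<in> A \<Longrightarrow> x \<in> carrier (V c) \<Longrightarrow>
      t (b + c) (a + (b + c)) (t c (b + c) x) = t c (a + (b + c)) x"
begin

abbreviation M where "M \<equiv> direct_sum_module D V t"

lemma D_zero: "0 \<in> D"
  using A_zero A_sub_D by blast

lemma D_add: "c \<in> D \<Longrightarrow> c' \<in> D \<Longrightarrow> c + c' \<in> D"
  using D_diff[of c "- c'"] D_diff[of 0 c'] D_zero by simp

lemma A_D: "a \<in> A \<Longrightarrow> a \<in> D"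
  using A_sub_D by blast

lemma t_zero:
  assumes "c \<in> D" "a \<in> A"
  shows "t c (a + c) \<zero>\<^bsub>V c\<^esub> = \<zero>\<^bsub>V (a + c)\<^esub>"
proof -
  interpret Vc: module ring_of_type_algebra "V c" using assms(1) by (rule module_V)
  interpret Va: module ring_of_type_algebra "V (a + c)" using assms by (simp add: module_V D_add A_D)
  have "t c (a + c) ((0::'k) \<odot>\<^bsub>V c\<^esub> \<zero>\<^bsub>V c\<^esub>) = \<zero>\<^bsub>V (a + c)\<^esub>"
    using assms t_smult[of c a "\<zero>\<^bsub>V c\<^esub>" 0] Va.smult_l_null[of "t c (a + c) \<zero>\<^bsub>V c\<^esub>"] t_closed[of c a "\<zero>\<^bsub>V c\<^esub>"]
    by simp
  then show ?thesis using Vc.smult_l_null[of "\<zero>\<^bsub>V c\<^esub>"] by simp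
qed

lemma carrier_M:
  "x \<in> carrier M \<longleftrightarrow> x \<in> (\<Pi>\<^sub>E c\<in>D. carrier (V c)) \<and> finite {c\<in>D. x c \<noteq> \<zero>\<^bsub>V c\<^esub>}"
  by (auto simp: direct_sum_module_def Let_def)

lemma zero_M: "\<zero>\<^bsub>M\<^esub> = (\<lambda>c\<in>D. \<zero>\<^bsub>V c\<^esub>)"
  and add_M: "x \<oplus>\<^bsub>M\<^esub> y = (\<lambda>c\<in>D. x c \<oplus>\<^bsub>V c\<^esub> y c)"
  and smult_M: "f \<odot>\<^bsub>M\<^esub> x = (\<lambda>c\<in>D. finsum (V c)
          (\<lambda>a. Poly_Mapping.lookup f a \<odot>\<^bsub>V c\<^esub> t (c - a) c (x (c - a))) (Poly_Mapping.keys f))"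
  and hcomp_M: "hcomp M c = {x \<in> carrier M. \<forall>c'\<in>D - {c}. x c' = \<zero>\<^bsub>V c'\<^esub>}"
  by (simp_all add: direct_sum_module_def Let_def)

lemma M_apply_closed: "x \<in> carrier M \<Longrightarrow> c \<in> D \<Longrightarrow> x c \<in> carrier (V c)"
  by (auto simp: carrier_M)

lemma t_term_closed:
  assumes "x \<in> carrier M" "c \<in> D" "a \<in> A"
  shows "t (c - a) c (x (c - a)) \<in> carrier (V c)"
  using t_closed[of "c - a" a "x (c - a)"] M_apply_closed[OF assms(1), of "c - a"] assms D_diff[of c a] A_D[of a] by auto

lemma smult_V_closed: "c \<in> D \<Longrightarrow> x \<in> carrier (V c) \<Longrightarrow> k \<odot>\<^bsub>V c\<^esub> x \<in> carrier (V c)"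
  using module.smult_closed[OF module_V] by fastforce

lemma zero_V_closed: "c \<in> D \<Longrightarrow> \<zero>\<^bsub>V c\<^esub> \<in> carrier (V c)"
  by (rule abelian_monoid.zero_closed[OF abelian_group.axioms(1)[OF module.axioms(2)[OF module_V]]])

lemma abelian_monoid_V: "c \<in> D \<Longrightarrow> abelian_monoid (V c)"
  by (rule abelian_group.axioms(1)[OF module.axioms(2)[OF module_V]])

lemma smult_V_zero: "c \<in> D \<Longrightarrow> k \<odot>\<^bsub>V c\<^esub> \<zero>\<^bsub>V c\<^esub> = \<zero>\<^bsub>V c\<^esub>"
  using module.smult_r_null[OF module_V] by fastforce

lemma smult_V_l_null: "c \<in> D \<Longrightarrow> x \<in> carrier (V c) \<Longrightarrow> 0 \<odot>\<^bsub>V c\<^esub> x = \<zero>\<^bsub>V c\<^esub>"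
  using module.smult_l_null[OF module_V, of c x] by simp

lemma single_smult_apply:
  assumes "x \<in> carrier M" "a \<in> A" "c \<in> D"
  shows "(Poly_Mapping.single a k \<odot>\<^bsub>M\<^esub> x) c = k \<odot>\<^bsub>V c\<^esub> t (c - a) c (x (c - a))"
proof -
  interpret Vc: module ring_of_type_algebra "V c" using assms(3) by (rule module_V)
  show ?thesis
    using assms t_term_closed[OF assms(1,3,2)] Vc.smult_l_null[of "t (c - a) c (x (c - a))"]
      Vc.smult_closed[of k "t (c - a) c (x (c - a))"]
    by (cases "k = 0") (auto simp: smult_M Vc.finsum_insert)
qed

text \<open>
  The sum that defines the action runs over the support of \<open>f\<close>; enlarging it makes the actions of
  different elements comparable.
\<close>

lemma smult_superset:
  assumes "x \<in> carrier M" "c \<in> D" "finite K" "Poly_Mapping.keys f \<subseteq> K" "K \<subseteq> A"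
  shows "(f \<odot>\<^bsub>M\<^esub> x) c =
    finsum (V c) (\<lambda>a. Poly_Mapping.lookup f a \<odot>\<^bsub>V c\<^esub> t (c - a) c (x (c - a))) K"
  unfolding smult_M using assms(2)
proof (simp, intro abelian_monoid.finsum_mono_neutral[OF abelian_monoid_V])
  show "(\<lambda>a. Poly_Mapping.lookup f a \<odot>\<^bsub>V c\<^esub> t (c - a) c (x (c - a))) \<in> K \<rightarrow> carrier (V c)"
    using assms t_term_closed by (auto intro!: smult_V_closed)
  fix a assume "a \<in> K - Poly_Mapping.keys f"
  then show "Poly_Mapping.lookup f a \<odot>\<^bsub>V c\<^esub> t (c - a) c (x (c - a)) = \<zero>\<^bsub>V c\<^esub>"
    using assms t_term_closed by (auto simp: in_keys_iff intro!: smult_V_l_null)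
qed (use assms in auto)

text \<open>
  Supports stay finite because the support of \<open>f x\<close> lies in the sumset of the supports of \<open>f\<close> and \<open>x\<close>.
\<close>

lemma smult_M_closed:
  assumes x: "x \<in> carrier M" and f: "Poly_Mapping.keys f \<subseteq> A"
  shows "f \<odot>\<^bsub>M\<^esub> x \<in> carrier M"
  unfolding carrier_M
proof
  have fin: "finite {c\<in>D. x c \<noteq> \<zero>\<^bsub>V c\<^esub>}" using x carrier_M by blast
  show "f \<odot>\<^bsub>M\<^esub> x \<in> (\<Pi>\<^sub>E c\<in>D. carrier (V c))"
    unfolding smult_M using x f t_term_closed
    by (auto intro!: abelian_monoid.finsum_closed[OF abelian_monoid_V] smult_V_closed)
  have "{c\<in>D. (f \<odot>\<^bsub>M\<^esub> x) c \<noteq> \<zero>\<^bsub>V c\<^esub>} \<subseteq> (\<lambda>(a, c). a + c) ` (Poly_Mapping.keys f \<times> {c\<in>D. x c \<noteq> \<zero>\<^bsub>V c\<^esub>})"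
  proof (rule subsetI, rule ccontr)
    fix c
    assume c: "c \<in> {c\<in>D. (f \<odot>\<^bsub>M\<^esub> x) c \<noteq> \<zero>\<^bsub>V c\<^esub>}"
      and notin: "c \<notin> (\<lambda>(a, c). a + c) ` (Poly_Mapping.keys f \<times> {c\<in>D. x c \<noteq> \<zero>\<^bsub>V c\<^esub>})"
    then have cD: "c \<in> D" by blast
    interpret Vc: abelian_monoid "V c" using cD by (rule abelian_monoid_V)
    have "x (c - a) = \<zero>\<^bsub>V (c - a)\<^esub>" if "a \<in> Poly_Mapping.keys f" for a
      using notin that cD f D_diff[of c a] A_D by (force simp: image_iff)
    then have "Poly_Mapping.lookup f a \<odot>\<^bsub>V c\<^esub> t (c - a) c (x (c - a)) = \<zero>\<^bsub>V c\<^esub>"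
      if "a \<in> Poly_Mapping.keys f" for a
      using that f cD t_zero[of "c - a" a] D_diff[of c a] A_D smult_V_zero by auto
    then have "(f \<odot>\<^bsub>M\<^esub> x) c = \<zero>\<^bsub>V c\<^esub>"
      using cD by (auto simp: smult_M intro!: Vc.add.finprod_one_eqI)
    then show False using c by simp
  qed
  then show "finite {c\<in>D. (f \<odot>\<^bsub>M\<^esub> x) c \<noteq> \<zero>\<^bsub>V c\<^esub>}"
    by (rule finite_subset) (use fin in auto)
qed

lemma abelian_group_M: "abelian_group M"
proof (rule abelian_groupI)
  fix x y assume x: "x \<in> carrier M" and y: "y \<in> carrier M"
  have "{c\<in>D. (x \<oplus>\<^bsub>M\<^esub> y) c \<noteq> \<zero>\<^bsub>V c\<^esub>} \<subseteq> {c\<in>D. x c \<noteq> \<zero>\<^bsub>V c\<^esub>} \<union> {c\<in>D. y c \<noteq> \<zero>\<^bsub>V c\<^esub>}"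
    using abelian_monoid.l_zero[OF abelian_monoid_V] zero_V_closed by (auto simp: add_M)
  moreover have "finite ({c\<in>D. x c \<noteq> \<zero>\<^bsub>V c\<^esub>} \<union> {c\<in>D. y c \<noteq> \<zero>\<^bsub>V c\<^esub>})"
    using x y by (simp add: carrier_M)
  moreover have "x \<oplus>\<^bsub>M\<^esub> y \<in> (\<Pi>\<^sub>E c\<in>D. carrier (V c))"
    using x y by (auto simp: add_M M_apply_closed intro!: abelian_monoid.a_closed[OF abelian_monoid_V])
  ultimately show "x \<oplus>\<^bsub>M\<^esub> y \<in> carrier M"
    unfolding carrier_M using finite_subset by blast
  show "x \<oplus>\<^bsub>M\<^esub> y = y \<oplus>\<^bsub>M\<^esub> x"
    using x y by (auto simp: add_M M_apply_closed intro!: restrict_ext abelian_monoid.a_comm[OF abelian_monoid_V])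
next
  show "\<zero>\<^bsub>M\<^esub> \<in> carrier M"
    using zero_V_closed by (auto simp: carrier_M zero_M cong: conj_cong)
next
  fix x y z assume "x \<in> carrier M" "y \<in> carrier M" "z \<in> carrier M"
  then show "x \<oplus>\<^bsub>M\<^esub> y \<oplus>\<^bsub>M\<^esub> z = x \<oplus>\<^bsub>M\<^esub> (y \<oplus>\<^bsub>M\<^esub> z)"
    by (auto simp: add_M M_apply_closed intro!: restrict_ext abelian_monoid.a_assoc[OF abelian_monoid_V])
next
  fix x assume x: "x \<in> carrier M"
  then show "\<zero>\<^bsub>M\<^esub> \<oplus>\<^bsub>M\<^esub> x = x"
    by (intro ext) (auto simp: add_M zero_M M_apply_closed abelian_monoid.l_zero[OF abelian_monoid_V] carrier_M PiE_def extensional_def)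
  have gr: "abelian_group (V c)" if "c \<in> D" for c using module.axioms(2)[OF module_V[OF that]] .
  have minus_zero: "\<ominus>\<^bsub>V c\<^esub> \<zero>\<^bsub>V c\<^esub> = \<zero>\<^bsub>V c\<^esub>" if "c \<in> D" for c
  proof -
    interpret Vc: abelian_group "V c" using that by (rule gr)
    show ?thesis using Vc.l_neg[of "\<zero>\<^bsub>V c\<^esub>"] by simp
  qed
  let ?y = "\<lambda>c\<in>D. \<ominus>\<^bsub>V c\<^esub> x c"
  have "{c\<in>D. ?y c \<noteq> \<zero>\<^bsub>V c\<^esub>} \<subseteq> {c\<in>D. x c \<noteq> \<zero>\<^bsub>V c\<^esub>}"
    using minus_zero by auto
  moreover have "finite {c\<in>D. x c \<noteq> \<zero>\<^bsub>V c\<^esub>}" using x by (simp add: carrier_M)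
  moreover have "?y \<in> (\<Pi>\<^sub>E c\<in>D. carrier (V c))"
    using x by (auto simp: M_apply_closed intro!: abelian_group.a_inv_closed[OF gr])
  ultimately have "?y \<in> carrier M"
    unfolding carrier_M using finite_subset by blast
  moreover have "?y \<oplus>\<^bsub>M\<^esub> x = \<zero>\<^bsub>M\<^esub>"
    using x by (auto simp: add_M zero_M M_apply_closed intro!: restrict_ext abelian_group.l_neg[OF gr])
  ultimately show "\<exists>y\<in>carrier M. y \<oplus>\<^bsub>M\<^esub> x = \<zero>\<^bsub>M\<^esub>" by blast
qed

lemma M_eqI:
  assumes "x \<in> carrier M" "y \<in> carrier M" "\<And>c. c \<in> D \<Longrightarrow> x c = y c"
  shows "x = y"
  using assms by (intro PiE_ext[of x D "\<lambda>c. carrier (V c)"]) (auto simp: carrier_M)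

text \<open>
  The distributive laws hold term by term. For associativity, both sides are additive in each scalar, and
  for monomials it is the composition law \<open>t_comp\<close> of the transition maps.
\<close>

lemma module_M: "module (monoid_algebra A) M"
proof (rule moduleI)
  show "cring (monoid_algebra A :: ('g \<Rightarrow>\<^sub>0 'k) ring)"
    by (rule cring_monoid_algebra) (use A_zero A_add in auto)
  show "abelian_group M" by (rule abelian_group_M)
  interpret M: abelian_group M by (rule abelian_group_M)
  show closed: "f \<odot>\<^bsub>M\<^esub> x \<in> carrier M" if "f \<in> carrier (monoid_algebra A)" "x \<in> carrier M" for f x
    using that by (simp add: smult_M_closed)
  show l_distr: "(f \<oplus>\<^bsub>monoid_algebra A\<^esub> g) \<odot>\<^bsub>M\<^esub> x = f \<odot>\<^bsub>M\<^esub> x \<oplus>\<^bsub>M\<^esub> g \<odot>\<^bsub>M\<^esub> x"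
    if f: "f \<in> carrier (monoid_algebra A)" and g: "g \<in> carrier (monoid_algebra A)" and x: "x \<in> carrier M" for f g x
  proof (rule M_eqI)
    have fg: "Poly_Mapping.keys (f + g) \<subseteq> A" using f g keys_add[of f g] by auto
    then show "(f \<oplus>\<^bsub>monoid_algebra A\<^esub> g) \<odot>\<^bsub>M\<^esub> x \<in> carrier M" using x by (simp add: smult_M_closed)
    show "f \<odot>\<^bsub>M\<^esub> x \<oplus>\<^bsub>M\<^esub> g \<odot>\<^bsub>M\<^esub> x \<in> carrier M"
      using closed f g x by simp
    fix c assume c: "c \<in> D"
    interpret Vc: module ring_of_type_algebra "V c" using c by (rule module_V)
    let ?K = "Poly_Mapping.keys f \<union> Poly_Mapping.keys g"
    let ?y = "\<lambda>a. t (c - a) c (x (c - a))"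
    have K: "finite ?K" "?K \<subseteq> A" using f g by auto
    have y: "?y a \<in> carrier (V c)" if "a \<in> ?K" for a using t_term_closed[OF x c] K(2) that by blast
    have cl: "k \<odot>\<^bsub>V c\<^esub> ?y a \<in> carrier (V c)" if "a \<in> ?K" for a k using smult_V_closed[OF c y[OF that]] .
    have "((f + g) \<odot>\<^bsub>M\<^esub> x) c = finsum (V c) (\<lambda>a. Poly_Mapping.lookup (f + g) a \<odot>\<^bsub>V c\<^esub> ?y a) ?K"
      by (rule smult_superset[OF x c K(1) keys_add K(2)])
    also have "\<dots> = finsum (V c) (\<lambda>a. Poly_Mapping.lookup f a \<odot>\<^bsub>V c\<^esub> ?y a \<oplus>\<^bsub>V c\<^esub> Poly_Mapping.lookup g a \<odot>\<^bsub>V c\<^esub> ?y a) ?K"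
    proof (rule Vc.M.finsum_cong')
      show "(\<lambda>a. Poly_Mapping.lookup f a \<odot>\<^bsub>V c\<^esub> ?y a \<oplus>\<^bsub>V c\<^esub> Poly_Mapping.lookup g a \<odot>\<^bsub>V c\<^esub> ?y a) \<in> ?K \<rightarrow> carrier (V c)"
        using cl by (intro funcsetI Vc.M.a_closed)
      fix a assume "a \<in> ?K"
      then show "Poly_Mapping.lookup (f + g) a \<odot>\<^bsub>V c\<^esub> ?y a =
          Poly_Mapping.lookup f a \<odot>\<^bsub>V c\<^esub> ?y a \<oplus>\<^bsub>V c\<^esub> Poly_Mapping.lookup g a \<odot>\<^bsub>V c\<^esub> ?y a"
        using Vc.smult_l_distr[OF _ _ y] by (simp add: lookup_add)
    qed simp
    also have "\<dots> = finsum (V c) (\<lambda>a. Poly_Mapping.lookup f a \<odot>\<^bsub>V c\<^esub> ?y a) ?K \<oplus>\<^bsub>V c\<^esub>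
        finsum (V c) (\<lambda>a. Poly_Mapping.lookup g a \<odot>\<^bsub>V c\<^esub> ?y a) ?K"
      using cl by (intro Vc.M.finsum_addf funcsetI)
    also have "\<dots> = (f \<odot>\<^bsub>M\<^esub> x) c \<oplus>\<^bsub>V c\<^esub> (g \<odot>\<^bsub>M\<^esub> x) c"
      using smult_superset[OF x c K(1) _ K(2), of f] smult_superset[OF x c K(1) _ K(2), of g] by simp
    finally show "((f \<oplus>\<^bsub>monoid_algebra A\<^esub> g) \<odot>\<^bsub>M\<^esub> x) c = (f \<odot>\<^bsub>M\<^esub> x \<oplus>\<^bsub>M\<^esub> g \<odot>\<^bsub>M\<^esub> x) c"
      using c by (simp add: add_M)
  qed
  show r_distr: "f \<odot>\<^bsub>M\<^esub> (x \<oplus>\<^bsub>M\<^esub> y) = f \<odot>\<^bsub>M\<^esub> x \<oplus>\<^bsub>M\<^esub> f \<odot>\<^bsub>M\<^esub> y"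
    if f: "f \<in> carrier (monoid_algebra A)" and x: "x \<in> carrier M" and y: "y \<in> carrier M" for f x y
  proof (rule M_eqI)
    show "f \<odot>\<^bsub>M\<^esub> (x \<oplus>\<^bsub>M\<^esub> y) \<in> carrier M" "f \<odot>\<^bsub>M\<^esub> x \<oplus>\<^bsub>M\<^esub> f \<odot>\<^bsub>M\<^esub> y \<in> carrier M"
      using f x y closed by simp_all
    fix c assume c: "c \<in> D"
    interpret Vc: module ring_of_type_algebra "V c" using c by (rule module_V)
    let ?t = "\<lambda>z a. t (c - a) c (z (c - a))"
    have cl: "k \<odot>\<^bsub>V c\<^esub> ?t z a \<in> carrier (V c)" if "a \<in> Poly_Mapping.keys f" "z \<in> carrier M" for a k z
      using smult_V_closed[OF c t_term_closed[OF that(2) c]] f that(1) by auto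
    have "(f \<odot>\<^bsub>M\<^esub> (x \<oplus>\<^bsub>M\<^esub> y)) c = finsum (V c) (\<lambda>a. Poly_Mapping.lookup f a \<odot>\<^bsub>V c\<^esub> ?t x a \<oplus>\<^bsub>V c\<^esub>
        Poly_Mapping.lookup f a \<odot>\<^bsub>V c\<^esub> ?t y a) (Poly_Mapping.keys f)"
      unfolding smult_M restrict_apply'[OF c]
    proof (rule Vc.M.finsum_cong')
      show "(\<lambda>a. Poly_Mapping.lookup f a \<odot>\<^bsub>V c\<^esub> ?t x a \<oplus>\<^bsub>V c\<^esub> Poly_Mapping.lookup f a \<odot>\<^bsub>V c\<^esub> ?t y a)
          \<in> Poly_Mapping.keys f \<rightarrow> carrier (V c)"
        using cl x y by (intro funcsetI Vc.M.a_closed)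
      fix a assume "a \<in> Poly_Mapping.keys f"
      then have a: "a \<in> A" using f by auto
      then have ca: "c - a \<in> D" using c A_D D_diff by blast
      have "?t (x \<oplus>\<^bsub>M\<^esub> y) a = ?t x a \<oplus>\<^bsub>V c\<^esub> ?t y a"
        using t_add[OF ca a M_apply_closed[OF x ca] M_apply_closed[OF y ca]] ca by (simp add: add_M)
      then show "Poly_Mapping.lookup f a \<odot>\<^bsub>V c\<^esub> ?t (x \<oplus>\<^bsub>M\<^esub> y) a =
          Poly_Mapping.lookup f a \<odot>\<^bsub>V c\<^esub> ?t x a \<oplus>\<^bsub>V c\<^esub> Poly_Mapping.lookup f a \<odot>\<^bsub>V c\<^esub> ?t y a"
        using Vc.smult_r_distr[OF _ t_term_closed[OF x c a] t_term_closed[OF y c a]] by simp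
    qed simp
    also have "\<dots> = (f \<odot>\<^bsub>M\<^esub> x) c \<oplus>\<^bsub>V c\<^esub> (f \<odot>\<^bsub>M\<^esub> y) c"
      unfolding smult_M restrict_apply'[OF c]
      using cl x y by (intro Vc.M.finsum_addf funcsetI)
    finally show "(f \<odot>\<^bsub>M\<^esub> (x \<oplus>\<^bsub>M\<^esub> y)) c = (f \<odot>\<^bsub>M\<^esub> x \<oplus>\<^bsub>M\<^esub> f \<odot>\<^bsub>M\<^esub> y) c"
      using c by (simp add: add_M)
  qed
  have zero_smult: "0 \<odot>\<^bsub>M\<^esub> x = \<zero>\<^bsub>M\<^esub>" for x
    by (auto simp: smult_M zero_M abelian_monoid.finsum_empty[OF abelian_monoid_V] intro!: restrict_ext)
  have single_single: "(Poly_Mapping.single a k * Poly_Mapping.single b l) \<odot>\<^bsub>M\<^esub> x =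
      Poly_Mapping.single a k \<odot>\<^bsub>M\<^esub> (Poly_Mapping.single b l \<odot>\<^bsub>M\<^esub> x)"
    if a: "a \<in> A" and b: "b \<in> A" and x: "x \<in> carrier M" for a b k l x
  proof -
    have xb: "Poly_Mapping.single b l \<odot>\<^bsub>M\<^esub> x \<in> carrier M" using closed b x by simp
    show ?thesis
      unfolding mult_single
    proof (rule M_eqI)
      show "Poly_Mapping.single (a + b) (k * l) \<odot>\<^bsub>M\<^esub> x \<in> carrier M"
        "Poly_Mapping.single a k \<odot>\<^bsub>M\<^esub> (Poly_Mapping.single b l \<odot>\<^bsub>M\<^esub> x) \<in> carrier M"
        using closed xb a A_add[OF a b] x by simp_all
      fix c assume c: "c \<in> D"
      let ?c = "c - a - b"
      have cs: "?c \<in> D" "c - a \<in> D" using c a b A_D D_diff by blast+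
      interpret Vc: module ring_of_type_algebra "V c" using c by (rule module_V)
      have xc: "x ?c \<in> carrier (V ?c)" using M_apply_closed x cs by blast
      have t1: "t ?c (c - a) (x ?c) \<in> carrier (V (c - a))" using t_closed[OF cs(1) b xc] by simp
      have t2: "t ?c c (x ?c) \<in> carrier (V c)" using t_term_closed[OF x c A_add[OF a b]] by (simp add: diff_diff_add)
      have "(Poly_Mapping.single a k \<odot>\<^bsub>M\<^esub> (Poly_Mapping.single b l \<odot>\<^bsub>M\<^esub> x)) c =
          k \<odot>\<^bsub>V c\<^esub> t (c - a) c (l \<odot>\<^bsub>V (c - a)\<^esub> t ?c (c - a) (x ?c))"
        using single_smult_apply[OF xb a c] single_smult_apply[OF x b cs(2)] by simp
      also have "\<dots> = k \<odot>\<^bsub>V c\<^esub> (l \<odot>\<^bsub>V c\<^esub> t (c - a) c (t ?c (c - a) (x ?c)))"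
        using t_smult[OF cs(2) a t1, of l] by simp
      also have "t (c - a) c (t ?c (c - a) (x ?c)) = t ?c c (x ?c)"
        using t_comp[OF cs(1) a b xc] by simp
      also have "k \<odot>\<^bsub>V c\<^esub> (l \<odot>\<^bsub>V c\<^esub> t ?c c (x ?c)) = (k * l) \<odot>\<^bsub>V c\<^esub> t ?c c (x ?c)"
        using Vc.smult_assoc1[OF _ _ t2, of k l] by simp
      also have "\<dots> = (Poly_Mapping.single (a + b) (k * l) \<odot>\<^bsub>M\<^esub> x) c"
        using single_smult_apply[OF x A_add[OF a b] c] by (simp add: diff_diff_add)
      finally show "(Poly_Mapping.single (a + b) (k * l) \<odot>\<^bsub>M\<^esub> x) c =
          (Poly_Mapping.single a k \<odot>\<^bsub>M\<^esub> (Poly_Mapping.single b l \<odot>\<^bsub>M\<^esub> x)) c" by simp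
    qed
  qed
  have keys_mult_A: "Poly_Mapping.keys (f * g) \<subseteq> A" if "Poly_Mapping.keys f \<subseteq> A" "Poly_Mapping.keys g \<subseteq> A"
    for f g :: "'g \<Rightarrow>\<^sub>0 'k"
    using keys_mult[of f g] that A_add by fastforce
  show "(f \<otimes>\<^bsub>monoid_algebra A\<^esub> g) \<odot>\<^bsub>M\<^esub> x = f \<odot>\<^bsub>M\<^esub> (g \<odot>\<^bsub>M\<^esub> x)"
    if "f \<in> carrier (monoid_algebra A)" and "g \<in> carrier (monoid_algebra A)" and x: "x \<in> carrier M" for f g x
  proof -
    have f: "Poly_Mapping.keys f \<subseteq> A" and g: "Poly_Mapping.keys g \<subseteq> A" using that by simp_all
    have "(f * g) \<odot>\<^bsub>M\<^esub> x = f \<odot>\<^bsub>M\<^esub> (g \<odot>\<^bsub>M\<^esub> x)"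
      using f
    proof (induction f rule: poly_mapping_on_induct)
      case zero
      show ?case by (simp add: zero_smult)
    next
      case (single a k)
      have sk: "Poly_Mapping.keys (Poly_Mapping.single a k) \<subseteq> A" using single by simp
      show ?case
        using g
      proof (induction g rule: poly_mapping_on_induct)
        case zero
        have "Poly_Mapping.single a k \<odot>\<^bsub>M\<^esub> \<zero>\<^bsub>M\<^esub> = \<zero>\<^bsub>M\<^esub>"
        proof (rule M_eqI)
          fix c assume c: "c \<in> D"
          have "c - a \<in> D" using c single A_D D_diff by blast
          then show "(Poly_Mapping.single a k \<odot>\<^bsub>M\<^esub> \<zero>\<^bsub>M\<^esub>) c = \<zero>\<^bsub>M\<^esub> c"
            using single_smult_apply[OF M.zero_closed single c, of k] t_zero[of "c - a" a] single c
            by (simp add: zero_M smult_V_zero)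
        qed (use sk smult_M_closed in auto)
        then show ?case by (simp add: zero_smult)
      next
        case (single b l)
        then show ?case using single_single \<open>a \<in> A\<close> x by blast
      next
        case (add g h)
        have cl: "Poly_Mapping.single a k * g \<in> carrier (monoid_algebra A)" "Poly_Mapping.single a k * h \<in> carrier (monoid_algebra A)"
          using keys_mult_A sk add by simp_all
        have "(Poly_Mapping.single a k * (g + h)) \<odot>\<^bsub>M\<^esub> x =
            (Poly_Mapping.single a k * g) \<odot>\<^bsub>M\<^esub> x \<oplus>\<^bsub>M\<^esub> (Poly_Mapping.single a k * h) \<odot>\<^bsub>M\<^esub> x"
          using l_distr[OF cl x] by (simp add: distrib_left)
        also have "\<dots> = Poly_Mapping.single a k \<odot>\<^bsub>M\<^esub> ((g + h) \<odot>\<^bsub>M\<^esub> x)"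
          using add sk l_distr[of g h x] r_distr[of "Poly_Mapping.single a k" "g \<odot>\<^bsub>M\<^esub> x" "h \<odot>\<^bsub>M\<^esub> x"]
            closed x by simp
        finally show ?case .
      qed
    next
      case (add f h)
      have cl: "f * g \<in> carrier (monoid_algebra A)" "h * g \<in> carrier (monoid_algebra A)"
        using keys_mult_A g add by simp_all
      have "((f + h) * g) \<odot>\<^bsub>M\<^esub> x = (f * g) \<odot>\<^bsub>M\<^esub> x \<oplus>\<^bsub>M\<^esub> (h * g) \<odot>\<^bsub>M\<^esub> x"
        using l_distr[OF cl x] by (simp add: distrib_right)
      also have "\<dots> = (f + h) \<odot>\<^bsub>M\<^esub> (g \<odot>\<^bsub>M\<^esub> x)"
        using add g l_distr[of f h "g \<odot>\<^bsub>M\<^esub> x"] closed x by simp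
      finally show ?case .
    qed
    then show ?thesis by simp
  qed
  show "\<one>\<^bsub>monoid_algebra A\<^esub> \<odot>\<^bsub>M\<^esub> x = x" if x: "x \<in> carrier M" for x
  proof (rule M_eqI)
    show "\<one>\<^bsub>monoid_algebra A\<^esub> \<odot>\<^bsub>M\<^esub> x \<in> carrier M"
      using A_zero x by (simp add: smult_M_closed flip: single_one)
    fix c assume c: "c \<in> D"
    interpret Vc: module ring_of_type_algebra "V c" using c by (rule module_V)
    show "(\<one>\<^bsub>monoid_algebra A\<^esub> \<odot>\<^bsub>M\<^esub> x) c = x c"
      using single_smult_apply[OF x A_zero c, of 1] t_id[OF c M_apply_closed[OF x c]]
        Vc.smult_one[OF M_apply_closed[OF x c]] by simp
  qed (use x in auto)
qed

lemma finsum_M_apply: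
  assumes "finite S" "F \<in> S \<rightarrow> carrier M" "c \<in> D"
  shows "finsum M F S c = finsum (V c) (\<lambda>s. F s c) S"
  using assms(1,2)
proof (induction S rule: finite_induct)
  case empty
  interpret M: abelian_group M by (rule abelian_group_M)
  interpret Vc: abelian_monoid "V c" using assms(3) by (rule abelian_monoid_V)
  show ?case using assms(3) by (simp add: zero_M)
next
  case (insert s S)
  interpret M: abelian_group M by (rule abelian_group_M)
  interpret Vc: abelian_monoid "V c" using assms(3) by (rule abelian_monoid_V)
  have "(\<lambda>s. F s c) \<in> S \<rightarrow> carrier (V c)" "F s c \<in> carrier (V c)"
    using insert.prems M_apply_closed[OF _ assms(3)] by auto
  then show ?case
    using insert assms(3) by (simp add: M.finsum_insert Vc.finsum_insert add_M)
qed

lemma hcomp_subgroup: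
  assumes "c \<in> D"
  shows "additive_subgroup (hcomp M c) M"
proof (rule additive_subgroupI)
  interpret M: abelian_group M by (rule abelian_group_M)
  show "subgroup (hcomp M c) (add_monoid M)"
  proof (rule group.subgroupI[OF M.a_group])
    show "hcomp M c \<subseteq> carrier (add_monoid M)" by (auto simp: hcomp_M)
    have "\<zero>\<^bsub>M\<^esub> \<in> hcomp M c" by (simp add: hcomp_M zero_M[THEN fun_cong])
    then show "hcomp M c \<noteq> {}" by blast
  next
    fix x assume x: "x \<in> hcomp M c"
    then have xM: "x \<in> carrier M" by (simp add: hcomp_M)
    have "(\<ominus>\<^bsub>M\<^esub> x) c' = \<zero>\<^bsub>V c'\<^esub>" if c': "c' \<in> D - {c}" for c'
    proof -
      interpret Vc: abelian_monoid "V c'" using c' by (intro abelian_monoid_V) blast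
      have "(\<ominus>\<^bsub>M\<^esub> x \<oplus>\<^bsub>M\<^esub> x) c' = \<zero>\<^bsub>V c'\<^esub>"
        using M.l_neg[OF xM] c' by (simp add: zero_M)
      then show ?thesis
        using c' x M_apply_closed[of "\<ominus>\<^bsub>M\<^esub> x" c'] xM by (simp add: add_M hcomp_M)
    qed
    then have "\<ominus>\<^bsub>M\<^esub> x \<in> hcomp M c" using xM by (simp add: hcomp_M)
    then show "inv\<^bsub>add_monoid M\<^esub> x \<in> hcomp M c" by (simp add: a_inv_def)
  next
    fix x y assume xy: "x \<in> hcomp M c" "y \<in> hcomp M c"
    then have "x \<oplus>\<^bsub>M\<^esub> y \<in> carrier M" by (simp add: hcomp_M)
    moreover have "(x \<oplus>\<^bsub>M\<^esub> y) c' = \<zero>\<^bsub>V c'\<^esub>" if c': "c' \<in> D - {c}" for c'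
    proof -
      interpret Vc: abelian_monoid "V c'" using c' by (intro abelian_monoid_V) blast
      show ?thesis using c' xy by (simp add: add_M hcomp_M)
    qed
    ultimately show "x \<otimes>\<^bsub>add_monoid M\<^esub> y \<in> hcomp M c" by (simp add: hcomp_M)
  qed
qed

text \<open>
  The coordinate at \<open>c\<close> of a sum of homogeneous elements only sees the summand of degree \<open>c\<close>. This gives
  the uniqueness of homogeneous decompositions.
\<close>

lemma homogeneous_decomposition_apply:
  assumes \<xi>: "\<xi> \<in> (\<Pi>\<^sub>E g\<in>D. hcomp M g)" and fin: "finite {g\<in>D. \<xi> g \<noteq> \<zero>\<^bsub>M\<^esub>}" and c: "c \<in> D"
  shows "finsum M \<xi> {g\<in>D. \<xi> g \<noteq> \<zero>\<^bsub>M\<^esub>} c = \<xi> c c"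
proof -
  interpret Vc: abelian_monoid "V c" using c by (rule abelian_monoid_V)
  have \<xi>M: "\<xi> g \<in> carrier M" if "g \<in> D" for g
    using PiE_mem[OF \<xi> that] by (simp add: hcomp_M)
  have off: "\<xi> g c = \<zero>\<^bsub>V c\<^esub>" if "g \<in> D" "g \<noteq> c" for g
    using PiE_mem[OF \<xi> that(1)] c that(2) by (auto simp: hcomp_M)
  let ?S = "{g\<in>D. \<xi> g \<noteq> \<zero>\<^bsub>M\<^esub>}"
  have "finsum M \<xi> ?S c = finsum (V c) (\<lambda>g. \<xi> g c) ?S"
    by (rule finsum_M_apply[OF fin _ c]) (use \<xi>M in auto)
  also have "\<dots> = finsum (V c) (\<lambda>g. \<xi> g c) (insert c ?S)"
    by (rule Vc.finsum_mono_neutral)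
      (use fin \<xi>M M_apply_closed c in \<open>auto simp: zero_M\<close>)
  also have "\<dots> = finsum (V c) (\<lambda>g. \<xi> g c) {c}"
    by (rule Vc.finsum_mono_neutral[symmetric])
      (use fin \<xi>M M_apply_closed c off in \<open>auto simp: zero_M\<close>)
  also have "\<dots> = \<xi> c c"
    using M_apply_closed[OF \<xi>M[OF c] c] by (simp add: Vc.finsum_insert)
  finally show ?thesis .
qed

text \<open>
  The component of degree \<open>g\<close> is \<open>x\<close> with all coordinates except the one at \<open>g\<close> set to zero.
\<close>

lemma homogeneous_decomposition:
  assumes x: "x \<in> carrier M"
  shows "\<exists>!\<xi>. \<xi> \<in> (\<Pi>\<^sub>E g\<in>D. hcomp M g) \<and> finite {g\<in>D. \<xi> g \<noteq> \<zero>\<^bsub>M\<^esub>} \<and>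
    x = finsum M \<xi> {g\<in>D. \<xi> g \<noteq> \<zero>\<^bsub>M\<^esub>}"
proof (rule ex1I)
  interpret M: abelian_group M by (rule abelian_group_M)
  let ?\<xi> = "\<lambda>g\<in>D. \<lambda>c\<in>D. if c = g then x c else \<zero>\<^bsub>V c\<^esub>"
  have fin: "finite {c\<in>D. x c \<noteq> \<zero>\<^bsub>V c\<^esub>}" using x by (simp add: carrier_M)
  have carr: "?\<xi> g \<in> carrier M" if "g \<in> D" for g
    unfolding carrier_M
  proof
    show "?\<xi> g \<in> (\<Pi>\<^sub>E c\<in>D. carrier (V c))"
      using that x M_apply_closed zero_V_closed by auto
    show "finite {c\<in>D. ?\<xi> g c \<noteq> \<zero>\<^bsub>V c\<^esub>}"
      by (rule finite_subset[of _ "{g}"]) (use that in auto)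
  qed
  have \<xi>: "?\<xi> \<in> (\<Pi>\<^sub>E g\<in>D. hcomp M g)" using carr by (auto simp: hcomp_M)
  have "{g\<in>D. ?\<xi> g \<noteq> \<zero>\<^bsub>M\<^esub>} \<subseteq> {c\<in>D. x c \<noteq> \<zero>\<^bsub>V c\<^esub>}"
    by (auto simp: zero_M intro!: restrict_ext split: if_splits)
  then have fin\<xi>: "finite {g\<in>D. ?\<xi> g \<noteq> \<zero>\<^bsub>M\<^esub>}" using fin by (rule finite_subset)
  have "x = finsum M ?\<xi> {g\<in>D. ?\<xi> g \<noteq> \<zero>\<^bsub>M\<^esub>}"
  proof (rule M_eqI[OF x])
    show "finsum M ?\<xi> {g\<in>D. ?\<xi> g \<noteq> \<zero>\<^bsub>M\<^esub>} \<in> carrier M"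
      by (rule M.finsum_closed) (use carr in auto)
    fix c assume c: "c \<in> D"
    show "x c = finsum M ?\<xi> {g\<in>D. ?\<xi> g \<noteq> \<zero>\<^bsub>M\<^esub>} c"
      unfolding homogeneous_decomposition_apply[OF \<xi> fin\<xi> c] using c by simp
  qed
  then show "?\<xi> \<in> (\<Pi>\<^sub>E g\<in>D. hcomp M g) \<and> finite {g\<in>D. ?\<xi> g \<noteq> \<zero>\<^bsub>M\<^esub>} \<and>
      x = finsum M ?\<xi> {g\<in>D. ?\<xi> g \<noteq> \<zero>\<^bsub>M\<^esub>}"
    using \<xi> fin\<xi> by blast
  fix \<eta>
  assume "\<eta> \<in> (\<Pi>\<^sub>E g\<in>D. hcomp M g) \<and> finite {g\<in>D. \<eta> g \<noteq> \<zero>\<^bsub>M\<^esub>} \<and>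
      x = finsum M \<eta> {g\<in>D. \<eta> g \<noteq> \<zero>\<^bsub>M\<^esub>}"
  then have \<eta>: "\<eta> \<in> (\<Pi>\<^sub>E g\<in>D. hcomp M g)" "finite {g\<in>D. \<eta> g \<noteq> \<zero>\<^bsub>M\<^esub>}"
      "x = finsum M \<eta> {g\<in>D. \<eta> g \<noteq> \<zero>\<^bsub>M\<^esub>}" by auto
  show "\<eta> = ?\<xi>"
  proof (rule PiE_ext[OF \<eta>(1) \<xi>])
    fix g assume g: "g \<in> D"
    show "\<eta> g = ?\<xi> g"
    proof (rule M_eqI)
      show "\<eta> g \<in> carrier M" using PiE_mem[OF \<eta>(1) g] by (simp add: hcomp_M)
      show "?\<xi> g \<in> carrier M" by (rule carr[OF g])
      fix c assume c: "c \<in> D"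
      show "\<eta> g c = ?\<xi> g c"
        using homogeneous_decomposition_apply[OF \<eta>(1,2) c] \<eta>(3) PiE_mem[OF \<eta>(1) g] c g
        by (auto simp: hcomp_M)
    qed
  qed
qed

lemma is_graded_module_M: "is_graded_module A D M"
  unfolding is_graded_module_def
proof (intro conjI ballI allI)
  fix a c k x assume a: "a \<in> A" and c: "c \<in> D" and x: "x \<in> hcomp M c"
  then have xM: "x \<in> carrier M" by (simp add: hcomp_M)
  have "(Poly_Mapping.single a k \<odot>\<^bsub>M\<^esub> x) c' = \<zero>\<^bsub>V c'\<^esub>" if c': "c' \<in> D - {a + c}" for c'
  proof -
    have ca: "c' - a \<in> D" "c' - a \<noteq> c" using c' a A_D D_diff by auto
    then have "x (c' - a) = \<zero>\<^bsub>V (c' - a)\<^esub>" using x by (simp add: hcomp_M)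
    then show ?thesis
      using c' single_smult_apply[OF xM a, of c' k] t_zero[OF ca(1) a] by (simp add: smult_V_zero)
  qed
  moreover have "Poly_Mapping.single a k \<odot>\<^bsub>M\<^esub> x \<in> carrier M" using smult_M_closed[OF xM] a by simp
  ultimately show "Poly_Mapping.single a k \<odot>\<^bsub>M\<^esub> x \<in> hcomp M (a + c)" by (simp add: hcomp_M)
qed (rule module_M hcomp_subgroup homogeneous_decomposition; assumption)+

end

section \<open>Isomorphisms of systems of vector spaces\<close>

lemma module_hom_zero:
  assumes f: "f \<in> module_hom R E F" and "abelian_group E" "abelian_group F"
  shows "f \<zero>\<^bsub>E\<^esub> = \<zero>\<^bsub>F\<^esub>"
proof -
  interpret E: abelian_group E by fact
  interpret F: abelian_group F by fact
  have "f \<zero>\<^bsub>E\<^esub> \<in> carrier F" using f by (auto simp: module_hom_def)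
  moreover have "f (\<zero>\<^bsub>E\<^esub> \<oplus>\<^bsub>E\<^esub> \<zero>\<^bsub>E\<^esub>) = f \<zero>\<^bsub>E\<^esub> \<oplus>\<^bsub>F\<^esub> f \<zero>\<^bsub>E\<^esub>"
    using f E.zero_closed unfolding module_hom_def by blast
  ultimately show ?thesis by (metis E.l_zero E.zero_closed F.add.r_cancel_one')
qed

lemma module_hom_finsum:
  assumes f: "f \<in> module_hom R E F" and "abelian_group E" "abelian_group F"
    and "finite S" and "g \<in> S \<rightarrow> carrier E"
  shows "f (finsum E g S) = finsum F (\<lambda>s. f (g s)) S"
  using assms(4,5)
proof (induction S rule: finite_induct)
  case empty
  interpret E: abelian_group E by fact
  interpret F: abelian_group F by fact
  show ?case using module_hom_zero[OF assms(1-3)] by simp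
next
  case (insert s S)
  interpret E: abelian_group E by fact
  interpret F: abelian_group F by fact
  have fc: "f x \<in> carrier F" if "x \<in> carrier E" for x using f that by (auto simp: module_hom_def)
  have g: "g \<in> S \<rightarrow> carrier E" "g s \<in> carrier E" using insert.prems by auto
  have "f (g s \<oplus>\<^bsub>E\<^esub> finsum E g S) = f (g s) \<oplus>\<^bsub>F\<^esub> f (finsum E g S)"
    using f g E.finsum_closed[OF g(1)] unfolding module_hom_def by blast
  moreover have "(\<lambda>s. f (g s)) \<in> S \<rightarrow> carrier F" using g fc by auto
  ultimately show ?case
    using insert g fc by (simp add: E.finsum_insert F.finsum_insert)
qed

text \<open>
  The map is applied coordinatewise. An injective linear map preserves and reflects zero coordinates, so supports
  and homogeneous components correspond; commuting with the transition maps is what makes it linear over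
  the monoid algebra.
\<close>

lemma direct_sum_graded_iso:
  fixes V :: "'g::ab_group_add \<Rightarrow> ('k::field, 'v) module" and W :: "'g \<Rightarrow> ('k, 'w) module"
  assumes V: "graded_system A D V t" and W: "graded_system A D W u"
    and iso: "\<And>c. c \<in> D \<Longrightarrow> is_module_iso ring_of_type_algebra (V c) (W c) (\<phi> c)"
    and nat: "\<And>c a x. c \<in> D \<Longrightarrow> a \<in> A \<Longrightarrow> x \<in> carrier (V c) \<Longrightarrow>
      \<phi> (a + c) (t c (a + c) x) = u c (a + c) (\<phi> c x)"
  shows "is_graded_iso A D (direct_sum_module D V t) (direct_sum_module D W u)
    (\<lambda>x\<in>carrier (direct_sum_module D V t). \<lambda>c\<in>D. \<phi> c (x c))"
proof -
  interpret V: graded_system A D V t by (rule V)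
  interpret W: graded_system A D W u by (rule W)
  let ?\<Phi> = "\<lambda>x. \<lambda>c\<in>D. \<phi> c (x c)"
  have hom: "\<phi> c \<in> module_hom ring_of_type_algebra (V c) (W c)" if "c \<in> D" for c
    using iso[OF that] by (simp add: is_module_iso_def)
  have bij: "bij_betw (\<phi> c) (carrier (V c)) (carrier (W c))" if "c \<in> D" for c
    using iso[OF that] by (simp add: is_module_iso_def)
  have agV: "abelian_group (V c)" and agW: "abelian_group (W c)" if "c \<in> D" for c
    using V.module_V[OF that] W.module_V[OF that] by (auto dest: module.axioms(2))
  have closed: "\<phi> c v \<in> carrier (W c)" if "c \<in> D" "v \<in> carrier (V c)" for c v
    using bij[OF that(1)] that(2) by (auto dest: bij_betwE)
  have inj: "v = w" if "c \<in> D" "v \<in> carrier (V c)" "w \<in> carrier (V c)" "\<phi> c v = \<phi> c w" for c v w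
    using bij_betw_imp_inj_on[OF bij[OF that(1)]] that(2-4) by (auto dest: inj_onD)
  have zero_iff: "\<phi> c v = \<zero>\<^bsub>W c\<^esub> \<longleftrightarrow> v = \<zero>\<^bsub>V c\<^esub>" if "c \<in> D" "v \<in> carrier (V c)" for c v
    using module_hom_zero[OF hom agV agW] inj[OF that(1,2) V.zero_V_closed] that by auto
  have \<phi>_add: "\<phi> c (v \<oplus>\<^bsub>V c\<^esub> w) = \<phi> c v \<oplus>\<^bsub>W c\<^esub> \<phi> c w"
    if "c \<in> D" "v \<in> carrier (V c)" "w \<in> carrier (V c)" for c v w
    using hom[OF that(1)] that(2,3) by (simp add: module_hom_def)
  have \<phi>_smult: "\<phi> c (k \<odot>\<^bsub>V c\<^esub> v) = k \<odot>\<^bsub>W c\<^esub> \<phi> c v"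
    if "c \<in> D" "v \<in> carrier (V c)" for c v k
    using hom[OF that(1)] that(2) by (simp add: module_hom_def)
  have \<Phi>_closed: "?\<Phi> x \<in> carrier W.M" if x: "x \<in> carrier V.M" for x
  proof -
    have "{c\<in>D. ?\<Phi> x c \<noteq> \<zero>\<^bsub>W c\<^esub>} = {c\<in>D. x c \<noteq> \<zero>\<^bsub>V c\<^esub>}"
      using zero_iff V.M_apply_closed[OF x] by auto
    moreover have "finite {c\<in>D. x c \<noteq> \<zero>\<^bsub>V c\<^esub>}" using x by (simp add: V.carrier_M)
    moreover have "?\<Phi> x \<in> (\<Pi>\<^sub>E c\<in>D. carrier (W c))"
      using closed V.M_apply_closed[OF x] by auto
    ultimately show ?thesis by (simp add: W.carrier_M)
  qed
  have \<Phi>_smult: "?\<Phi> (f \<odot>\<^bsub>V.M\<^esub> x) = f \<odot>\<^bsub>W.M\<^esub> ?\<Phi> x"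
    if f: "Poly_Mapping.keys f \<subseteq> A" and x: "x \<in> carrier V.M" for f x
  proof (rule W.M_eqI)
    show "?\<Phi> (f \<odot>\<^bsub>V.M\<^esub> x) \<in> carrier W.M" "f \<odot>\<^bsub>W.M\<^esub> ?\<Phi> x \<in> carrier W.M"
      using \<Phi>_closed V.smult_M_closed W.smult_M_closed f x by blast+
    fix c assume c: "c \<in> D"
    interpret Wc: abelian_monoid "W c" using c by (rule W.abelian_monoid_V)
    let ?v = "\<lambda>a. t (c - a) c (x (c - a))"
    have v: "?v a \<in> carrier (V c)" if "a \<in> Poly_Mapping.keys f" for a
      using V.t_term_closed[OF x c] f that by blast
    have "?\<Phi> (f \<odot>\<^bsub>V.M\<^esub> x) c =
        finsum (W c) (\<lambda>a. \<phi> c (Poly_Mapping.lookup f a \<odot>\<^bsub>V c\<^esub> ?v a)) (Poly_Mapping.keys f)"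
      using module_hom_finsum[OF hom[OF c] agV[OF c] agW[OF c], of "Poly_Mapping.keys f"
          "\<lambda>a. Poly_Mapping.lookup f a \<odot>\<^bsub>V c\<^esub> ?v a"] V.smult_V_closed[OF c v] c
      by (simp add: V.smult_M)
    also have "\<dots> = (f \<odot>\<^bsub>W.M\<^esub> ?\<Phi> x) c"
      unfolding W.smult_M restrict_apply'[OF c]
    proof (rule Wc.finsum_cong')
      show "(\<lambda>a. Poly_Mapping.lookup f a \<odot>\<^bsub>W c\<^esub> u (c - a) c (?\<Phi> x (c - a)))
          \<in> Poly_Mapping.keys f \<rightarrow> carrier (W c)"
        using W.smult_V_closed[OF c W.t_term_closed[OF \<Phi>_closed[OF x] c]] f by blast
      fix a assume a: "a \<in> Poly_Mapping.keys f"
      then have aA: "a \<in> A" using f by blast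
      have ca: "c - a \<in> D" using c aA V.A_D V.D_diff by blast
      show "\<phi> c (Poly_Mapping.lookup f a \<odot>\<^bsub>V c\<^esub> ?v a) =
          Poly_Mapping.lookup f a \<odot>\<^bsub>W c\<^esub> u (c - a) c (?\<Phi> x (c - a))"
        using \<phi>_smult[OF c v[OF a]] nat[OF ca aA V.M_apply_closed[OF x ca]] ca by simp
    qed simp
    finally show "?\<Phi> (f \<odot>\<^bsub>V.M\<^esub> x) c = (f \<odot>\<^bsub>W.M\<^esub> ?\<Phi> x) c" .
  qed
  have \<Phi>_inj: "x = y" if x: "x \<in> carrier V.M" and y: "y \<in> carrier V.M" and eq: "?\<Phi> x = ?\<Phi> y" for x y
  proof (rule V.M_eqI[OF x y])
    fix c assume c: "c \<in> D"
    show "x c = y c"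
      using fun_cong[OF eq, of c] c inj[OF c V.M_apply_closed[OF x c] V.M_apply_closed[OF y c]] by simp
  qed
  have \<Phi>_surj: "\<exists>x\<in>carrier V.M. ?\<Phi> x = y" if y: "y \<in> carrier W.M" for y
  proof
    let ?x = "\<lambda>c\<in>D. inv_into (carrier (V c)) (\<phi> c) (y c)"
    have x: "?x c \<in> carrier (V c)" "\<phi> c (?x c) = y c" if "c \<in> D" for c
    proof -
      have "y c \<in> \<phi> c ` carrier (V c)"
        using W.M_apply_closed[OF y that] bij_betw_imp_surj_on[OF bij[OF that]] by simp
      then show "?x c \<in> carrier (V c)" "\<phi> c (?x c) = y c"
        using that by (simp_all add: inv_into_into f_inv_into_f)
    qed
    have "{c\<in>D. ?x c \<noteq> \<zero>\<^bsub>V c\<^esub>} = {c\<in>D. y c \<noteq> \<zero>\<^bsub>W c\<^esub>}"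
      using zero_iff x by (metis (no_types, lifting))
    then have "finite {c\<in>D. ?x c \<noteq> \<zero>\<^bsub>V c\<^esub>}"
      using y by (simp only: W.carrier_M)
    moreover have "?x \<in> (\<Pi>\<^sub>E c\<in>D. carrier (V c))" using x(1) by auto
    ultimately show xM: "?x \<in> carrier V.M" unfolding V.carrier_M by blast
    show "?\<Phi> ?x = y"
      by (rule W.M_eqI[OF \<Phi>_closed[OF xM] y]) (use x(2) in simp)
  qed
  have hcomp_iff: "?\<Phi> x \<in> hcomp W.M c \<longleftrightarrow> x \<in> hcomp V.M c" if "x \<in> carrier V.M" for x c
    using \<Phi>_closed[OF that] that zero_iff[OF _ V.M_apply_closed[OF that]]
    by (auto simp: V.hcomp_M W.hcomp_M)
  let ?\<Psi> = "\<lambda>x\<in>carrier V.M. ?\<Phi> x"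
  have sub: "hcomp V.M c \<subseteq> carrier V.M" "hcomp W.M c \<subseteq> carrier W.M" for c
    by (auto simp: V.hcomp_M W.hcomp_M)
  have image: "?\<Psi> ` hcomp V.M c = hcomp W.M c" for c
  proof (intro equalityI subsetI)
    fix y assume "y \<in> ?\<Psi> ` hcomp V.M c"
    then obtain x where "x \<in> hcomp V.M c" "y = ?\<Psi> x" by blast
    then show "y \<in> hcomp W.M c" using hcomp_iff[of x c] sub by auto
  next
    fix y assume y: "y \<in> hcomp W.M c"
    then obtain x where x: "x \<in> carrier V.M" "?\<Phi> x = y" using \<Phi>_surj sub by blast
    then have "x \<in> hcomp V.M c" using hcomp_iff[OF x(1), of c] y by simp
    then show "y \<in> ?\<Psi> ` hcomp V.M c" using x by (intro image_eqI[of _ _ x]) simp_all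
  qed
  have "?\<Psi> \<in> module_hom (monoid_algebra A) V.M W.M"
    unfolding module_hom_def
  proof (intro CollectI conjI ballI)
    show "?\<Psi> \<in> carrier V.M \<rightarrow>\<^sub>E carrier W.M" using \<Phi>_closed by auto
    fix x assume x: "x \<in> carrier V.M"
    {
      fix y assume y: "y \<in> carrier V.M"
      have xy: "x \<oplus>\<^bsub>V.M\<^esub> y \<in> carrier V.M"
        using abelian_monoid.a_closed[OF abelian_group.axioms(1)[OF V.abelian_group_M] x y] .
      have "?\<Phi> (x \<oplus>\<^bsub>V.M\<^esub> y) = ?\<Phi> x \<oplus>\<^bsub>W.M\<^esub> ?\<Phi> y"
        using \<phi>_add V.M_apply_closed[OF x] V.M_apply_closed[OF y]
        by (auto simp: V.add_M W.add_M intro!: restrict_ext)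
      then show "?\<Psi> (x \<oplus>\<^bsub>V.M\<^esub> y) = ?\<Psi> x \<oplus>\<^bsub>W.M\<^esub> ?\<Psi> y" using x y xy by simp
    }
  next
    fix f :: "'g \<Rightarrow>\<^sub>0 'k" and x assume "f \<in> carrier (monoid_algebra A)" and x: "x \<in> carrier V.M"
    then have f: "Poly_Mapping.keys f \<subseteq> A" by simp
    show "?\<Psi> (f \<odot>\<^bsub>V.M\<^esub> x) = f \<odot>\<^bsub>W.M\<^esub> ?\<Psi> x"
      using \<Phi>_smult[OF f x] V.smult_M_closed[OF x f] x by simp
  qed
  then have "?\<Psi> \<in> graded_hom A D V.M W.M"
    using image by (simp add: graded_hom_def)
  moreover have "bij_betw ?\<Psi> (carrier V.M) (carrier W.M)"
    unfolding bij_betw_def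
  proof
    show "inj_on ?\<Psi> (carrier V.M)" using \<Phi>_inj by (auto intro!: inj_onI)
    show "?\<Psi> ` carrier V.M = carrier W.M"
      using \<Phi>_closed \<Phi>_surj by (auto simp: image_iff)
  qed
  ultimately show ?thesis
    unfolding is_graded_iso_def using V.is_graded_module_M W.is_graded_module_M image by blast
qed

section \<open>The components of the lifting and of the module of limits\<close>

lemma function_space_simps [simp]:
  "carrier (function_space I C E) = C"
  "\<zero>\<^bsub>function_space I C E\<^esub> = (\<lambda>i\<in>I. \<zero>\<^bsub>E\<^esub>)"
  "x \<oplus>\<^bsub>function_space I C E\<^esub> y = (\<lambda>i\<in>I. x i \<oplus>\<^bsub>E\<^esub> y i)"
  "k \<odot>\<^bsub>function_space I C E\<^esub> x = (\<lambda>i\<in>I. Poly_Mapping.single 0 k \<odot>\<^bsub>E\<^esub> x i)"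
  by (simp_all add: function_space_def)

text \<open>
  Additive inverses are obtained by scaling with \<open>-1\<close>.
\<close>

lemma module_function_space:
  fixes E :: "('g::ab_group_add \<Rightarrow>\<^sub>0 'k::field, 'e, 'p) module_scheme"
  assumes E: "module (monoid_algebra A) E" and A: "0 \<in> A"
    and C: "C \<subseteq> (I \<rightarrow>\<^sub>E carrier E)" and zero: "(\<lambda>i\<in>I. \<zero>\<^bsub>E\<^esub>) \<in> C"
    and add: "\<And>x y. x \<in> C \<Longrightarrow> y \<in> C \<Longrightarrow> (\<lambda>i\<in>I. x i \<oplus>\<^bsub>E\<^esub> y i) \<in> C"
    and smult: "\<And>k x. x \<in> C \<Longrightarrow> (\<lambda>i\<in>I. Poly_Mapping.single 0 k \<odot>\<^bsub>E\<^esub> x i) \<in> C"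
  shows "module ring_of_type_algebra (function_space I C E)"
proof (rule moduleI)
  interpret E: module "monoid_algebra A" E by (rule E)
  have const: "Poly_Mapping.single 0 k \<in> carrier (monoid_algebra A)" for k :: 'k
    using A by simp
  have val: "x i \<in> carrier E" if "x \<in> C" "i \<in> I" for x i
    using C that by blast
  have ext: "x = y" if "x \<in> C" "y \<in> C" "\<And>i. i \<in> I \<Longrightarrow> x i = y i" for x y
    using C that by (intro PiE_ext[of x I "\<lambda>_. carrier E" y]) auto
  show "cring (ring_of_type_algebra :: 'k ring)" by (rule cring_from_type_algebra)
  show "abelian_group (function_space I C E)"
  proof (rule abelian_groupI; (unfold function_space_simps)?)
    fix x assume x: "x \<in> C"
    let ?y = "\<lambda>i\<in>I. Poly_Mapping.single 0 (- 1) \<odot>\<^bsub>E\<^esub> x i"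
    have "Poly_Mapping.single 0 (- 1) \<odot>\<^bsub>E\<^esub> x i \<oplus>\<^bsub>E\<^esub> x i = \<zero>\<^bsub>E\<^esub>" if i: "i \<in> I" for i
    proof -
      have "Poly_Mapping.single 0 (- 1) \<odot>\<^bsub>E\<^esub> x i \<oplus>\<^bsub>E\<^esub> Poly_Mapping.single 0 1 \<odot>\<^bsub>E\<^esub> x i =
          (Poly_Mapping.single 0 (- 1) + Poly_Mapping.single 0 (1 :: 'k)) \<odot>\<^bsub>E\<^esub> x i"
        using E.smult_l_distr[OF const const val[OF x i], of "- 1" 1] by simp
      also have "\<dots> = \<zero>\<^bsub>E\<^esub>"
      proof -
        have "Poly_Mapping.single 0 (- 1) + Poly_Mapping.single 0 1 = (0 :: 'g \<Rightarrow>\<^sub>0 'k)"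
          by (metis single_add add.left_inverse single_zero)
        then show ?thesis using E.smult_l_null[OF val[OF x i]] by simp
      qed
      finally show ?thesis using E.smult_one[OF val[OF x i]] by simp
    qed
    then have "(\<lambda>i\<in>I. ?y i \<oplus>\<^bsub>E\<^esub> x i) = (\<lambda>i\<in>I. \<zero>\<^bsub>E\<^esub>)" by (intro restrict_ext) simp
    then show "\<exists>y\<in>C. (\<lambda>i\<in>I. y i \<oplus>\<^bsub>E\<^esub> x i) = (\<lambda>i\<in>I. \<zero>\<^bsub>E\<^esub>)" using smult[OF x] by blast
  next
    fix x y assume "x \<in> C" "y \<in> C"
    then show "(\<lambda>i\<in>I. x i \<oplus>\<^bsub>E\<^esub> y i) = (\<lambda>i\<in>I. y i \<oplus>\<^bsub>E\<^esub> x i)"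
      using val E.M.a_comm by (intro restrict_ext) blast
  next
    fix x y z assume "x \<in> C" "y \<in> C" "z \<in> C"
    then show "(\<lambda>i\<in>I. (\<lambda>i\<in>I. x i \<oplus>\<^bsub>E\<^esub> y i) i \<oplus>\<^bsub>E\<^esub> z i) = (\<lambda>i\<in>I. x i \<oplus>\<^bsub>E\<^esub> (\<lambda>i\<in>I. y i \<oplus>\<^bsub>E\<^esub> z i) i)"
      using val E.M.a_assoc by (intro restrict_ext) simp
  next
    fix x assume x: "x \<in> C"
    show "(\<lambda>i\<in>I. (\<lambda>i\<in>I. \<zero>\<^bsub>E\<^esub>) i \<oplus>\<^bsub>E\<^esub> x i) = x"
      by (rule ext[OF add[OF zero x] x]) (use val[OF x] in simp)
  qed (use zero add in blast)+
  fix k l :: 'k and x y assume x: "x \<in> carrier (function_space I C E)"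
  then have xC: "x \<in> C" by simp
  show "k \<odot>\<^bsub>function_space I C E\<^esub> x \<in> carrier (function_space I C E)" using smult[OF xC] by simp
  show "(k \<oplus>\<^bsub>ring_of_type_algebra\<^esub> l) \<odot>\<^bsub>function_space I C E\<^esub> x =
      k \<odot>\<^bsub>function_space I C E\<^esub> x \<oplus>\<^bsub>function_space I C E\<^esub> l \<odot>\<^bsub>function_space I C E\<^esub> x"
    using E.smult_l_distr[OF const const val[OF xC], of _ k l]
    by (auto simp: single_add intro!: restrict_ext)
  show "(k \<otimes>\<^bsub>ring_of_type_algebra\<^esub> l) \<odot>\<^bsub>function_space I C E\<^esub> x =
      k \<odot>\<^bsub>function_space I C E\<^esub> (l \<odot>\<^bsub>function_space I C E\<^esub> x)"
    using E.smult_assoc1[OF const const val[OF xC], of _ k l]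
    by (auto simp: mult_single intro!: restrict_ext)
  show "\<one>\<^bsub>ring_of_type_algebra\<^esub> \<odot>\<^bsub>function_space I C E\<^esub> x = x"
  proof (rule ext)
    show "\<one>\<^bsub>ring_of_type_algebra\<^esub> \<odot>\<^bsub>function_space I C E\<^esub> x \<in> C" using smult[OF xC, of 1] by simp
    fix i assume "i \<in> I"
    then show "(\<one>\<^bsub>ring_of_type_algebra\<^esub> \<odot>\<^bsub>function_space I C E\<^esub> x) i = x i"
      using E.smult_one[OF val[OF xC]] by simp
  qed (rule xC)
  assume y: "y \<in> carrier (function_space I C E)"
  then have yC: "y \<in> C" by simp
  show "k \<odot>\<^bsub>function_space I C E\<^esub> (x \<oplus>\<^bsub>function_space I C E\<^esub> y) =
      k \<odot>\<^bsub>function_space I C E\<^esub> x \<oplus>\<^bsub>function_space I C E\<^esub> k \<odot>\<^bsub>function_space I C E\<^esub> y"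
    using E.smult_r_distr[OF const val[OF xC] val[OF yC], of _ _ k]
    by (auto intro!: restrict_ext)
qed

text \<open>
  The underlying set of \<open>S\<^sub>(\<^sub>-\<^sub>c\<^sub>)\<close>, described through \<open>U\<^sub>c\<close>, so that both constructions refer to the same
  set of characters.
\<close>

definition truncation :: "'m::ab_group_add N_real set \<Rightarrow> 'm ray_index \<Rightarrow> ('m \<Rightarrow>\<^sub>0 'k::field) set" where
  "truncation \<sigma> c = {f. Poly_Mapping.keys f \<subseteq> U_set \<sigma> c}"

lemma S_shift_uminus:
  "carrier (S_shift \<sigma> (- c)) = truncation \<sigma> c"
  "x \<oplus>\<^bsub>S_shift \<sigma> (- c)\<^esub> y = x + y"
  "x \<odot>\<^bsub>S_shift \<sigma> (- c)\<^esub> y = x * y"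
  "hcomp (S_shift \<sigma> (- c)) m = {f. Poly_Mapping.keys f \<subseteq> U_set \<sigma> c \<inter> {m}}"
  by (simp_all add: S_shift_def U_set_def truncation_def Let_def)

lemma truncation_add: "f \<in> truncation \<sigma> c \<Longrightarrow> g \<in> truncation \<sigma> c \<Longrightarrow> f + g \<in> truncation \<sigma> c"
  using keys_add[of f g] by (auto simp: truncation_def)

lemma single_in_truncation: "m \<in> U_set \<sigma> c \<Longrightarrow> Poly_Mapping.single m k \<in> truncation \<sigma> c"
  by (simp add: truncation_def)

lemma N_rays_zero: "0 \<in> N_rays \<sigma>"
  by (simp add: N_rays_def Z_rays_def)

lemma N_rays_add: "a \<in> N_rays \<sigma> \<Longrightarrow> b \<in> N_rays \<sigma> \<Longrightarrow> a + b \<in> N_rays \<sigma>"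
  using keys_add[of a b] by (auto simp: N_rays_def Z_rays_def lookup_add)

lemma N_rays_subset: "N_rays \<sigma> \<subseteq> Z_rays \<sigma>"
  by (auto simp: N_rays_def)

lemma Z_rays_diff: "c \<in> Z_rays \<sigma> \<Longrightarrow> c' \<in> Z_rays \<sigma> \<Longrightarrow> c - c' \<in> Z_rays \<sigma>"
  using keys_diff[of c c'] by (auto simp: Z_rays_def)

lemma U_set_antimono:
  assumes "a \<in> N_rays \<sigma>" shows "U_set \<sigma> (a + c) \<subseteq> U_set \<sigma> c"
proof
  fix m assume m: "m \<in> U_set \<sigma> (a + c)"
  have "real_of_int (Poly_Mapping.lookup c \<rho>) \<le> real_of_int (Poly_Mapping.lookup (a + c) \<rho>)" for \<rho>
    using assms by (simp add: N_rays_def lookup_add)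
  then show "m \<in> U_set \<sigma> c" using m order_trans unfolding U_set_def by blast
qed

lemma truncation_antimono: "a \<in> N_rays \<sigma> \<Longrightarrow> truncation \<sigma> (a + c) \<subseteq> truncation \<sigma> c"
  unfolding truncation_def using U_set_antimono by blast

locale toric_module =
  fixes \<sigma> :: "'m::ab_group_add N_real set"
    and E :: "('m \<Rightarrow>\<^sub>0 'k::field, 'e, 'm) graded_module"
  assumes rational: "rational_polyhedral_cone \<sigma>" and strictly_convex: "strictly_convex_cone \<sigma>"
    and graded: "is_graded_module (sigma_M \<sigma>) UNIV E"

sublocale toric_module \<subseteq> module "monoid_algebra (sigma_M \<sigma>)" E
  using graded by (simp add: is_graded_module_def)

context toric_module begin

lemma U_set_add: "a \<in> sigma_M \<sigma> \<Longrightarrow> m \<in> U_set \<sigma> c \<Longrightarrow> a + m \<in> U_set \<sigma> c"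
  by (rule U_set_sigma_M[OF rational strictly_convex])

lemma truncation_mult:
  assumes "Poly_Mapping.keys r \<subseteq> sigma_M \<sigma>" "f \<in> truncation \<sigma> c"
  shows "r * f \<in> truncation \<sigma> c"
  using keys_mult[of r f] assms U_set_add unfolding truncation_def by fastforce

lemma hcomp_subgroup: "additive_subgroup (hcomp E m) E"
  using graded by (simp add: is_graded_module_def)

lemma hcomp_closed: "x \<in> hcomp E m \<Longrightarrow> x \<in> carrier E"
  using additive_subgroup.a_subset[OF hcomp_subgroup] by blast

lemma hcomp_zero: "\<zero>\<^bsub>E\<^esub> \<in> hcomp E m"
  by (rule additive_subgroup.zero_closed[OF hcomp_subgroup])

lemma hcomp_add: "x \<in> hcomp E m \<Longrightarrow> y \<in> hcomp E m \<Longrightarrow> x \<oplus>\<^bsub>E\<^esub> y \<in> hcomp E m"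
  by (rule additive_subgroup.a_closed[OF hcomp_subgroup])

lemma hcomp_single:
  "a \<in> sigma_M \<sigma> \<Longrightarrow> x \<in> hcomp E m \<Longrightarrow> Poly_Mapping.single a k \<odot>\<^bsub>E\<^esub> x \<in> hcomp E (a + m)"
  using graded by (simp add: is_graded_module_def)

lemma hcomp_scalar: "x \<in> hcomp E m \<Longrightarrow> Poly_Mapping.single 0 k \<odot>\<^bsub>E\<^esub> x \<in> hcomp E m"
  using hcomp_single[OF sigma_M_zero, of x m k] by simp

lemma scalar_closed: "x \<in> carrier E \<Longrightarrow> Poly_Mapping.single 0 k \<odot>\<^bsub>E\<^esub> x \<in> carrier E"
  by (rule smult_closed) (simp_all add: sigma_M_zero)

lemma smult_scalar_commute:
  assumes "Poly_Mapping.keys r \<subseteq> sigma_M \<sigma>" "x \<in> carrier E"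
  shows "r \<odot>\<^bsub>E\<^esub> (Poly_Mapping.single 0 k \<odot>\<^bsub>E\<^esub> x) = Poly_Mapping.single 0 k \<odot>\<^bsub>E\<^esub> (r \<odot>\<^bsub>E\<^esub> x)"
proof -
  have k: "Poly_Mapping.single 0 k \<in> carrier (monoid_algebra (sigma_M \<sigma>))"
    and r: "r \<in> carrier (monoid_algebra (sigma_M \<sigma>))"
    using assms(1) by (simp_all add: sigma_M_zero)
  show ?thesis
    using smult_assoc1[OF r k assms(2)] smult_assoc1[OF k r assms(2)] by (simp add: mult.commute)
qed

text \<open>
  Writing \<open>m' = a + m\<close> removes the second index, which makes compatibility look like linearity over the
  characters \<open>\<chi>(a)\<close>.
\<close>

lemma in_limit_component_iff:
  "x \<in> carrier (limit_component \<sigma> E c) \<longleftrightarrow> x \<in> (\<Pi>\<^sub>E m\<in>U_set \<sigma> c. hcomp E m) \<and>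
    (\<forall>m\<in>U_set \<sigma> c. \<forall>a\<in>sigma_M \<sigma>. Poly_Mapping.single a 1 \<odot>\<^bsub>E\<^esub> x m = x (a + m))"
  (is "?L \<longleftrightarrow> ?R")
proof
  assume L: ?L
  then have "chi (a + m - m) \<odot>\<^bsub>E\<^esub> x m = x (a + m)" if "m \<in> U_set \<sigma> c" "a \<in> sigma_M \<sigma>" for m a
  proof -
    have "le_cone \<sigma> m (a + m)" using that(2) by (simp add: le_cone_def)
    moreover have "\<forall>m\<in>U_set \<sigma> c. \<forall>m'\<in>U_set \<sigma> c. le_cone \<sigma> m m' \<longrightarrow> chi (m' - m) \<odot>\<^bsub>E\<^esub> x m = x m'"
      using L by (simp add: limit_component_def)
    ultimately show ?thesis using that(1) U_set_add[OF that(2,1)] by blast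
  qed
  then have "Poly_Mapping.single a 1 \<odot>\<^bsub>E\<^esub> x m = x (a + m)" if "m \<in> U_set \<sigma> c" "a \<in> sigma_M \<sigma>" for m a
    using that by (simp add: chi_def)
  with L show ?R by (auto simp: limit_component_def)
next
  assume R: ?R
  have "chi (m' - m) \<odot>\<^bsub>E\<^esub> x m = x m'" if "m \<in> U_set \<sigma> c" "le_cone \<sigma> m m'" for m m'
  proof -
    have "m' - m \<in> sigma_M \<sigma>" using that(2) by (simp add: le_cone_def)
    then have "Poly_Mapping.single (m' - m) 1 \<odot>\<^bsub>E\<^esub> x m = x (m' - m + m)" using R that(1) by blast
    then show ?thesis by (simp add: chi_def)
  qed
  with R show ?L by (simp add: limit_component_def)
qed

lemma limit_component_simps [simp]:
  "\<zero>\<^bsub>limit_component \<sigma> E c\<^esub> = (\<lambda>i\<in>U_set \<sigma> c. \<zero>\<^bsub>E\<^esub>)"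
  "x \<oplus>\<^bsub>limit_component \<sigma> E c\<^esub> y = (\<lambda>i\<in>U_set \<sigma> c. x i \<oplus>\<^bsub>E\<^esub> y i)"
  "k \<odot>\<^bsub>limit_component \<sigma> E c\<^esub> x = (\<lambda>i\<in>U_set \<sigma> c. Poly_Mapping.single 0 k \<odot>\<^bsub>E\<^esub> x i)"
  by (simp_all add: limit_component_def)

lemma in_lifting_component_iff:
  "\<psi> \<in> carrier (lifting_component \<sigma> E c) \<longleftrightarrow> \<psi> \<in> truncation \<sigma> c \<rightarrow>\<^sub>E carrier E \<and>
    (\<forall>f\<in>truncation \<sigma> c. \<forall>g\<in>truncation \<sigma> c. \<psi> (f + g) = \<psi> f \<oplus>\<^bsub>E\<^esub> \<psi> g) \<and>
    (\<forall>r f. Poly_Mapping.keys r \<subseteq> sigma_M \<sigma> \<longrightarrow> f \<in> truncation \<sigma> c \<longrightarrow> \<psi> (r * f) = r \<odot>\<^bsub>E\<^esub> \<psi> f) \<and>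
    (\<forall>m f. Poly_Mapping.keys f \<subseteq> U_set \<sigma> c \<inter> {m} \<longrightarrow> \<psi> f \<in> hcomp E m)"
  by (simp add: lifting_component_def graded_hom_def module_hom_def S_shift_uminus image_subset_iff) blast

lemma lifting_component_simps [simp]:
  "\<zero>\<^bsub>lifting_component \<sigma> E c\<^esub> = (\<lambda>i\<in>truncation \<sigma> c. \<zero>\<^bsub>E\<^esub>)"
  "x \<oplus>\<^bsub>lifting_component \<sigma> E c\<^esub> y = (\<lambda>i\<in>truncation \<sigma> c. x i \<oplus>\<^bsub>E\<^esub> y i)"
  "k \<odot>\<^bsub>lifting_component \<sigma> E c\<^esub> x = (\<lambda>i\<in>truncation \<sigma> c. Poly_Mapping.single 0 k \<odot>\<^bsub>E\<^esub> x i)"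
  by (simp_all add: lifting_component_def S_shift_uminus)

lemma module_limit_component: "module ring_of_type_algebra (limit_component \<sigma> E c)"
proof -
  let ?C = "carrier (limit_component \<sigma> E c)"
  have single_closed: "Poly_Mapping.single a (1::'k) \<in> carrier (monoid_algebra (sigma_M \<sigma>))"
    if "a \<in> sigma_M \<sigma>" for a using that by simp
  have val: "x m \<in> hcomp E m" if "x \<in> ?C" "m \<in> U_set \<sigma> c" for x m
    using that by (auto simp: in_limit_component_iff)
  have "module ring_of_type_algebra (function_space (U_set \<sigma> c) ?C E)"
  proof (rule module_function_space)
    show "module (monoid_algebra (sigma_M \<sigma>)) E" ..
    show "0 \<in> sigma_M \<sigma>" by (rule sigma_M_zero)
    show "?C \<subseteq> (U_set \<sigma> c \<rightarrow>\<^sub>E carrier E)"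
      using hcomp_closed by (fastforce simp: in_limit_component_iff)
    show "(\<lambda>i\<in>U_set \<sigma> c. \<zero>\<^bsub>E\<^esub>) \<in> ?C"
      using hcomp_zero single_closed U_set_add
      by (auto simp: in_limit_component_iff smult_r_null simp del: monoid_algebra_simps)
    fix x y assume x: "x \<in> ?C" and y: "y \<in> ?C"
    show "(\<lambda>i\<in>U_set \<sigma> c. x i \<oplus>\<^bsub>E\<^esub> y i) \<in> ?C"
      unfolding in_limit_component_iff
    proof (intro conjI ballI)
      show "(\<lambda>i\<in>U_set \<sigma> c. x i \<oplus>\<^bsub>E\<^esub> y i) \<in> (\<Pi>\<^sub>E m\<in>U_set \<sigma> c. hcomp E m)"
        using val[OF x] val[OF y] hcomp_add by auto
      fix m a assume m: "m \<in> U_set \<sigma> c" and a: "a \<in> sigma_M \<sigma>"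
      have "Poly_Mapping.single a 1 \<odot>\<^bsub>E\<^esub> (x m \<oplus>\<^bsub>E\<^esub> y m) = x (a + m) \<oplus>\<^bsub>E\<^esub> y (a + m)"
        using smult_r_distr[OF single_closed[OF a] hcomp_closed[OF val[OF x m]] hcomp_closed[OF val[OF y m]]]
          x y m a by (simp add: in_limit_component_iff)
      then show "Poly_Mapping.single a 1 \<odot>\<^bsub>E\<^esub> (\<lambda>i\<in>U_set \<sigma> c. x i \<oplus>\<^bsub>E\<^esub> y i) m =
          (\<lambda>i\<in>U_set \<sigma> c. x i \<oplus>\<^bsub>E\<^esub> y i) (a + m)"
        using m U_set_add[OF a m] by simp
    qed
  next
    fix k x assume x: "x \<in> ?C"
    show "(\<lambda>i\<in>U_set \<sigma> c. Poly_Mapping.single 0 k \<odot>\<^bsub>E\<^esub> x i) \<in> ?C"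
      unfolding in_limit_component_iff
    proof (intro conjI ballI)
      show "(\<lambda>i\<in>U_set \<sigma> c. Poly_Mapping.single 0 k \<odot>\<^bsub>E\<^esub> x i) \<in> (\<Pi>\<^sub>E m\<in>U_set \<sigma> c. hcomp E m)"
        using val[OF x] hcomp_scalar by auto
      fix m a assume m: "m \<in> U_set \<sigma> c" and a: "a \<in> sigma_M \<sigma>"
      have "Poly_Mapping.single a 1 \<odot>\<^bsub>E\<^esub> (Poly_Mapping.single 0 k \<odot>\<^bsub>E\<^esub> x m) =
          Poly_Mapping.single 0 k \<odot>\<^bsub>E\<^esub> x (a + m)"
        using smult_scalar_commute[of "Poly_Mapping.single a 1" "x m" k] hcomp_closed[OF val[OF x m]] x m a
        by (simp add: in_limit_component_iff)
      then show "Poly_Mapping.single a 1 \<odot>\<^bsub>E\<^esub> (\<lambda>i\<in>U_set \<sigma> c. Poly_Mapping.single 0 k \<odot>\<^bsub>E\<^esub> x i) m =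
          (\<lambda>i\<in>U_set \<sigma> c. Poly_Mapping.single 0 k \<odot>\<^bsub>E\<^esub> x i) (a + m)"
        using m U_set_add[OF a m] by simp
    qed
  qed
  then show ?thesis by (simp add: limit_component_def)
qed

lemma lifting_val: "\<psi> \<in> carrier (lifting_component \<sigma> E c) \<Longrightarrow> f \<in> truncation \<sigma> c \<Longrightarrow> \<psi> f \<in> carrier E"
  by (auto simp: in_lifting_component_iff)

lemma lifting_mult:
  assumes "\<psi> \<in> carrier (lifting_component \<sigma> E c)" "Poly_Mapping.keys r \<subseteq> sigma_M \<sigma>" "f \<in> truncation \<sigma> c"
  shows "\<psi> (r * f) = r \<odot>\<^bsub>E\<^esub> \<psi> f"
  using assms unfolding in_lifting_component_iff by blast

lemma homogeneous_in_truncation: "Poly_Mapping.keys f \<subseteq> U_set \<sigma> c \<inter> {m} \<Longrightarrow> f \<in> truncation \<sigma> c"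
  by (auto simp: truncation_def)

lemma module_lifting_component: "module ring_of_type_algebra (lifting_component \<sigma> E c)"
proof -
  let ?C = "carrier (lifting_component \<sigma> E c)" and ?S = "truncation \<sigma> c"
  have "module ring_of_type_algebra (function_space ?S ?C E)"
  proof (rule module_function_space)
    show "module (monoid_algebra (sigma_M \<sigma>)) E" ..
    show "0 \<in> sigma_M \<sigma>" by (rule sigma_M_zero)
    show "?C \<subseteq> (?S \<rightarrow>\<^sub>E carrier E)" by (auto simp: in_lifting_component_iff)
    show "(\<lambda>f\<in>?S. \<zero>\<^bsub>E\<^esub>) \<in> ?C"
      unfolding in_lifting_component_iff
      using smult_r_null
      by (auto simp: truncation_add truncation_mult hcomp_zero homogeneous_in_truncation)
    fix \<psi> \<eta> assume \<psi>: "\<psi> \<in> ?C" and \<eta>: "\<eta> \<in> ?C"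
    show "(\<lambda>f\<in>?S. \<psi> f \<oplus>\<^bsub>E\<^esub> \<eta> f) \<in> ?C"
      unfolding in_lifting_component_iff
    proof (intro conjI ballI allI impI)
      show "(\<lambda>f\<in>?S. \<psi> f \<oplus>\<^bsub>E\<^esub> \<eta> f) \<in> ?S \<rightarrow>\<^sub>E carrier E"
        using lifting_val[OF \<psi>] lifting_val[OF \<eta>] by auto
    next
      fix f g :: "'m \<Rightarrow>\<^sub>0 'k" assume f: "f \<in> ?S" and g: "g \<in> ?S"
      have "\<psi> (f + g) \<oplus>\<^bsub>E\<^esub> \<eta> (f + g) = (\<psi> f \<oplus>\<^bsub>E\<^esub> \<psi> g) \<oplus>\<^bsub>E\<^esub> (\<eta> f \<oplus>\<^bsub>E\<^esub> \<eta> g)"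
        using \<psi> \<eta> f g by (simp add: in_lifting_component_iff)
      also have "\<dots> = (\<psi> f \<oplus>\<^bsub>E\<^esub> \<eta> f) \<oplus>\<^bsub>E\<^esub> (\<psi> g \<oplus>\<^bsub>E\<^esub> \<eta> g)"
        using lifting_val[OF \<psi> f] lifting_val[OF \<psi> g] lifting_val[OF \<eta> f] lifting_val[OF \<eta> g]
        by (simp add: M.a_ac)
      finally show "(\<lambda>f\<in>?S. \<psi> f \<oplus>\<^bsub>E\<^esub> \<eta> f) (f + g) =
          (\<lambda>f\<in>?S. \<psi> f \<oplus>\<^bsub>E\<^esub> \<eta> f) f \<oplus>\<^bsub>E\<^esub> (\<lambda>f\<in>?S. \<psi> f \<oplus>\<^bsub>E\<^esub> \<eta> f) g"
        using f g truncation_add[OF f g] by simp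
    next
      fix r f :: "'m \<Rightarrow>\<^sub>0 'k" assume r: "Poly_Mapping.keys r \<subseteq> sigma_M \<sigma>" and f: "f \<in> ?S"
      have "\<psi> (r * f) \<oplus>\<^bsub>E\<^esub> \<eta> (r * f) = r \<odot>\<^bsub>E\<^esub> (\<psi> f \<oplus>\<^bsub>E\<^esub> \<eta> f)"
        using \<psi> \<eta> f r smult_r_distr[of r "\<psi> f" "\<eta> f"] lifting_val[OF \<psi> f] lifting_val[OF \<eta> f]
        by (simp add: in_lifting_component_iff)
      then show "(\<lambda>f\<in>?S. \<psi> f \<oplus>\<^bsub>E\<^esub> \<eta> f) (r * f) = r \<odot>\<^bsub>E\<^esub> (\<lambda>f\<in>?S. \<psi> f \<oplus>\<^bsub>E\<^esub> \<eta> f) f"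
        using f truncation_mult[OF r f] by simp
    next
      fix m and f :: "'m \<Rightarrow>\<^sub>0 'k" assume f: "Poly_Mapping.keys f \<subseteq> U_set \<sigma> c \<inter> {m}"
      then show "(\<lambda>f\<in>?S. \<psi> f \<oplus>\<^bsub>E\<^esub> \<eta> f) f \<in> hcomp E m"
        using \<psi> \<eta> hcomp_add homogeneous_in_truncation[OF f] by (simp add: in_lifting_component_iff)
    qed
  next
    fix k \<psi> assume \<psi>: "\<psi> \<in> ?C"
    let ?k = "Poly_Mapping.single 0 k :: 'm \<Rightarrow>\<^sub>0 'k"
    have k: "?k \<in> carrier (monoid_algebra (sigma_M \<sigma>))" by (simp add: sigma_M_zero)
    show "(\<lambda>f\<in>?S. ?k \<odot>\<^bsub>E\<^esub> \<psi> f) \<in> ?C"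
      unfolding in_lifting_component_iff
    proof (intro conjI ballI allI impI)
      show "(\<lambda>f\<in>?S. ?k \<odot>\<^bsub>E\<^esub> \<psi> f) \<in> ?S \<rightarrow>\<^sub>E carrier E"
        using lifting_val[OF \<psi>] scalar_closed by auto
    next
      fix f g :: "'m \<Rightarrow>\<^sub>0 'k" assume f: "f \<in> ?S" and g: "g \<in> ?S"
      have "?k \<odot>\<^bsub>E\<^esub> \<psi> (f + g) = ?k \<odot>\<^bsub>E\<^esub> \<psi> f \<oplus>\<^bsub>E\<^esub> ?k \<odot>\<^bsub>E\<^esub> \<psi> g"
        using \<psi> f g smult_r_distr[OF k lifting_val[OF \<psi> f] lifting_val[OF \<psi> g]]
        by (simp add: in_lifting_component_iff)
      then show "(\<lambda>f\<in>?S. ?k \<odot>\<^bsub>E\<^esub> \<psi> f) (f + g) = (\<lambda>f\<in>?S. ?k \<odot>\<^bsub>E\<^esub> \<psi> f) f \<oplus>\<^bsub>E\<^esub> (\<lambda>f\<in>?S. ?k \<odot>\<^bsub>E\<^esub> \<psi> f) g"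
        using f g truncation_add[OF f g] by simp
    next
      fix r f :: "'m \<Rightarrow>\<^sub>0 'k" assume r: "Poly_Mapping.keys r \<subseteq> sigma_M \<sigma>" and f: "f \<in> ?S"
      have "?k \<odot>\<^bsub>E\<^esub> \<psi> (r * f) = r \<odot>\<^bsub>E\<^esub> (?k \<odot>\<^bsub>E\<^esub> \<psi> f)"
        using \<psi> f r smult_scalar_commute[OF r lifting_val[OF \<psi> f]] by (simp add: in_lifting_component_iff)
      then show "(\<lambda>f\<in>?S. ?k \<odot>\<^bsub>E\<^esub> \<psi> f) (r * f) = r \<odot>\<^bsub>E\<^esub> (\<lambda>f\<in>?S. ?k \<odot>\<^bsub>E\<^esub> \<psi> f) f"
        using f truncation_mult[OF r f] by simp
    next
      fix m and f :: "'m \<Rightarrow>\<^sub>0 'k" assume f: "Poly_Mapping.keys f \<subseteq> U_set \<sigma> c \<inter> {m}"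
      then show "(\<lambda>f\<in>?S. ?k \<odot>\<^bsub>E\<^esub> \<psi> f) f \<in> hcomp E m"
        using \<psi> hcomp_scalar homogeneous_in_truncation[OF f] by (simp add: in_lifting_component_iff)
    qed
  qed
  then show ?thesis by (simp add: lifting_component_def S_shift_uminus)
qed

section \<open>Evaluation at the characters\<close>

text \<open>
  Restricting to the lifting component makes this map extensional, as homomorphisms are required to be.
\<close>

definition evaluation :: "'m ray_index \<Rightarrow> (('m \<Rightarrow>\<^sub>0 'k) \<Rightarrow> 'e) \<Rightarrow> 'm \<Rightarrow> 'e" where
  "evaluation c = (\<lambda>\<psi>\<in>carrier (lifting_component \<sigma> E c). \<lambda>m\<in>U_set \<sigma> c. \<psi> (chi m))"

text \<open>
  Compatibility of the values is linearity of \<open>\<psi>\<close> with respect to \<open>\<chi>(a)\<close>, applied to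
  \<open>\<chi>(a) \<chi>(m) = \<chi>(a + m)\<close>.
\<close>

lemma evaluation_closed:
  assumes \<psi>: "\<psi> \<in> carrier (lifting_component \<sigma> E c)"
  shows "evaluation c \<psi> \<in> carrier (limit_component \<sigma> E c)"
  unfolding in_limit_component_iff
proof (intro conjI ballI)
  have "\<psi> (chi m) \<in> hcomp E m" if "m \<in> U_set \<sigma> c" for m
    using \<psi> that by (simp add: in_lifting_component_iff chi_def)
  then show "evaluation c \<psi> \<in> (\<Pi>\<^sub>E m\<in>U_set \<sigma> c. hcomp E m)" using \<psi> by (auto simp: evaluation_def)
  fix m a assume m: "m \<in> U_set \<sigma> c" and a: "a \<in> sigma_M \<sigma>"
  have "\<psi> (Poly_Mapping.single a 1 * chi m) = Poly_Mapping.single a 1 \<odot>\<^bsub>E\<^esub> \<psi> (chi m)"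
    by (rule lifting_mult[OF \<psi>]) (use a m in \<open>simp_all add: chi_def single_in_truncation\<close>)
  then show "Poly_Mapping.single a 1 \<odot>\<^bsub>E\<^esub> evaluation c \<psi> m = evaluation c \<psi> (a + m)"
    using \<psi> m U_set_add[OF a m] by (simp add: evaluation_def chi_def mult_single)
qed

lemma lifting_zero:
  assumes \<psi>: "\<psi> \<in> carrier (lifting_component \<sigma> E c)"
  shows "\<psi> 0 = \<zero>\<^bsub>E\<^esub>"
proof -
  have z: "0 \<in> truncation \<sigma> c" by (simp add: truncation_def)
  have "\<psi> (0 * 0) = 0 \<odot>\<^bsub>E\<^esub> \<psi> 0" using \<psi> z by (intro lifting_mult) simp_all
  then show ?thesis using smult_l_null[OF lifting_val[OF \<psi> z]] by simp
qed

lemma lifting_single: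
  assumes \<psi>: "\<psi> \<in> carrier (lifting_component \<sigma> E c)" and m: "m \<in> U_set \<sigma> c"
  shows "\<psi> (Poly_Mapping.single m k) = Poly_Mapping.single 0 k \<odot>\<^bsub>E\<^esub> \<psi> (chi m)"
proof -
  have "\<psi> (Poly_Mapping.single 0 k * chi m) = Poly_Mapping.single 0 k \<odot>\<^bsub>E\<^esub> \<psi> (chi m)"
    by (rule lifting_mult[OF \<psi>]) (use m in \<open>simp_all add: chi_def single_in_truncation sigma_M_zero\<close>)
  then show ?thesis by (simp add: chi_def mult_single)
qed

lemma evaluation_inj: "inj_on (evaluation c) (carrier (lifting_component \<sigma> E c))"
proof (rule inj_onI)
  fix \<psi> \<eta>
  assume \<psi>: "\<psi> \<in> carrier (lifting_component \<sigma> E c)" and \<eta>: "\<eta> \<in> carrier (lifting_component \<sigma> E c)"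
    and eq: "evaluation c \<psi> = evaluation c \<eta>"
  have chi: "\<psi> (chi m) = \<eta> (chi m)" if "m \<in> U_set \<sigma> c" for m
    using fun_cong[OF eq, of m] \<psi> \<eta> that by (simp add: evaluation_def)
  have "\<psi> f = \<eta> f" if "f \<in> truncation \<sigma> c" for f
  proof -
    have "Poly_Mapping.keys f \<subseteq> U_set \<sigma> c" using that by (simp add: truncation_def)
    then show ?thesis
    proof (induction f rule: poly_mapping_on_induct)
      case zero
      show ?case using lifting_zero[OF \<psi>] lifting_zero[OF \<eta>] by simp
    next
      case (single m k)
      then show ?case using lifting_single[OF \<psi>] lifting_single[OF \<eta>] chi by simp
    next
      case (add f g)
      then have "f \<in> truncation \<sigma> c" "g \<in> truncation \<sigma> c" by (simp_all add: truncation_def)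
      then show ?case using add \<psi> \<eta> by (simp add: in_lifting_component_iff)
    qed
  qed
  then show "\<psi> = \<eta>"
    using \<psi> \<eta> by (intro PiE_ext[of \<psi> "truncation \<sigma> c" "\<lambda>_. carrier E" \<eta>]) (auto simp: in_lifting_component_iff)
qed

text \<open>
  The scalar \<open>k\<close> acts on \<open>E\<close> as \<open>k \<chi>(0)\<close>, so this is the extension of \<open>\<chi>(m) \<mapsto> x m\<close> to a \<open>K\<close>-linear map.
\<close>

definition linear_extension :: "'m ray_index \<Rightarrow> ('m \<Rightarrow> 'e) \<Rightarrow> ('m \<Rightarrow>\<^sub>0 'k) \<Rightarrow> 'e" where
  "linear_extension c x = (\<lambda>f\<in>truncation \<sigma> c.
     finsum E (\<lambda>m. Poly_Mapping.single 0 (Poly_Mapping.lookup f m) \<odot>\<^bsub>E\<^esub> x m) (Poly_Mapping.keys f))"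

context
  fixes c x assumes x: "x \<in> carrier (limit_component \<sigma> E c)"
begin

lemma family_closed: "m \<in> U_set \<sigma> c \<Longrightarrow> x m \<in> hcomp E m" "m \<in> U_set \<sigma> c \<Longrightarrow> x m \<in> carrier E"
  using x hcomp_closed by (auto simp: in_limit_component_iff)

lemma family_transition: "m \<in> U_set \<sigma> c \<Longrightarrow> a \<in> sigma_M \<sigma> \<Longrightarrow> Poly_Mapping.single a 1 \<odot>\<^bsub>E\<^esub> x m = x (a + m)"
  using x by (auto simp: in_limit_component_iff)

lemma linear_extension_superset:
  assumes "f \<in> truncation \<sigma> c" "finite K" "Poly_Mapping.keys f \<subseteq> K" "K \<subseteq> U_set \<sigma> c"
  shows "linear_extension c x f =
    finsum E (\<lambda>m. Poly_Mapping.single 0 (Poly_Mapping.lookup f m) \<odot>\<^bsub>E\<^esub> x m) K"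
  unfolding linear_extension_def restrict_apply'[OF assms(1)]
proof (rule M.finsum_mono_neutral[OF assms(2,3)])
  show "(\<lambda>m. Poly_Mapping.single 0 (Poly_Mapping.lookup f m) \<odot>\<^bsub>E\<^esub> x m) \<in> K \<rightarrow> carrier E"
    using scalar_closed[OF family_closed(2)] assms(4) by blast
  fix m assume m: "m \<in> K - Poly_Mapping.keys f"
  then have "x m \<in> carrier E" using family_closed(2) assms(4) by blast
  from smult_l_null[OF this]
  show "Poly_Mapping.single 0 (Poly_Mapping.lookup f m) \<odot>\<^bsub>E\<^esub> x m = \<zero>\<^bsub>E\<^esub>"
    using m by (simp add: in_keys_iff)
qed

lemma linear_extension_closed: "f \<in> truncation \<sigma> c \<Longrightarrow> linear_extension c x f \<in> carrier E"
  unfolding linear_extension_def truncation_def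
  using scalar_closed[OF family_closed(2)] by (auto intro!: M.finsum_closed)

lemma linear_extension_add:
  assumes f: "f \<in> truncation \<sigma> c" and g: "g \<in> truncation \<sigma> c"
  shows "linear_extension c x (f + g) = linear_extension c x f \<oplus>\<^bsub>E\<^esub> linear_extension c x g"
proof -
  let ?K = "Poly_Mapping.keys f \<union> Poly_Mapping.keys g"
  let ?s = "\<lambda>f m. Poly_Mapping.single 0 (Poly_Mapping.lookup f m) \<odot>\<^bsub>E\<^esub> x m"
  have K: "finite ?K" "?K \<subseteq> U_set \<sigma> c" using f g by (auto simp: truncation_def)
  have cl: "?s h m \<in> carrier E" if "m \<in> ?K" for h m
    using scalar_closed[OF family_closed(2)] K(2) that by blast
  have const: "Poly_Mapping.single 0 k \<in> carrier (monoid_algebra (sigma_M \<sigma>))" for k :: 'k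
    by (simp add: sigma_M_zero)
  have "linear_extension c x (f + g) = finsum E (?s (f + g)) ?K"
    by (rule linear_extension_superset[OF truncation_add[OF f g] K(1) keys_add K(2)])
  also have "\<dots> = finsum E (\<lambda>m. ?s f m \<oplus>\<^bsub>E\<^esub> ?s g m) ?K"
  proof (rule M.finsum_cong')
    fix m assume "m \<in> ?K"
    then have "x m \<in> carrier E" using family_closed(2) K(2) by blast
    from smult_l_distr[OF const const this]
    show "?s (f + g) m = ?s f m \<oplus>\<^bsub>E\<^esub> ?s g m" by (simp add: lookup_add single_add)
  qed (use cl in auto)
  also have "\<dots> = finsum E (?s f) ?K \<oplus>\<^bsub>E\<^esub> finsum E (?s g) ?K"
    using cl by (intro M.finsum_addf funcsetI)
  also have "\<dots> = linear_extension c x f \<oplus>\<^bsub>E\<^esub> linear_extension c x g"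
    using linear_extension_superset[OF f K(1) _ K(2)] linear_extension_superset[OF g K(1) _ K(2)] by simp
  finally show ?thesis .
qed

lemma linear_extension_single:
  assumes m: "m \<in> U_set \<sigma> c"
  shows "linear_extension c x (Poly_Mapping.single m k) = Poly_Mapping.single 0 k \<odot>\<^bsub>E\<^esub> x m"
  using linear_extension_superset[OF single_in_truncation[OF m, of k], of "{m}"] m
    scalar_closed[OF family_closed(2)[OF m]] by (simp add: M.finsum_insert)

lemma linear_extension_zero: "linear_extension c x 0 = \<zero>\<^bsub>E\<^esub>"
  using linear_extension_superset[of 0 "{}"] by (simp add: truncation_def)

text \<open>
  Compatibility of the family is used for \<open>f = \<chi>(m)\<close>, where it gives
  \<open>\<chi>(a + m) \<mapsto> x (a + m) = \<chi>(a) (x m)\<close>; the general case follows by additivity.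
\<close>

lemma linear_extension_single_mult:
  assumes a: "a \<in> sigma_M \<sigma>" and f: "f \<in> truncation \<sigma> c"
  shows "linear_extension c x (Poly_Mapping.single a k * f) = Poly_Mapping.single a k \<odot>\<^bsub>E\<^esub> linear_extension c x f"
proof -
  have ak: "Poly_Mapping.single a k \<in> carrier (monoid_algebra (sigma_M \<sigma>))" for k :: 'k using a by simp
  have const: "Poly_Mapping.single 0 k \<in> carrier (monoid_algebra (sigma_M \<sigma>))" for k :: 'k
    by (simp add: sigma_M_zero)
  have "Poly_Mapping.keys f \<subseteq> U_set \<sigma> c" using f by (simp add: truncation_def)
  then show ?thesis
  proof (induction f rule: poly_mapping_on_induct)
    case zero
    show ?case using smult_r_null[OF ak] by (simp add: linear_extension_zero)
  next
    case (single m l)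
    have "linear_extension c x (Poly_Mapping.single a k * Poly_Mapping.single m l) =
        Poly_Mapping.single 0 (k * l) \<odot>\<^bsub>E\<^esub> (Poly_Mapping.single a 1 \<odot>\<^bsub>E\<^esub> x m)"
      using linear_extension_single[OF U_set_add[OF a single]] family_transition[OF single a]
      by (simp add: mult_single)
    also have "\<dots> = Poly_Mapping.single a (k * l) \<odot>\<^bsub>E\<^esub> x m"
      using smult_assoc1[OF const ak family_closed(2)[OF single], of "k * l" 1] by (simp add: mult_single)
    also have "\<dots> = Poly_Mapping.single a k \<odot>\<^bsub>E\<^esub> (Poly_Mapping.single 0 l \<odot>\<^bsub>E\<^esub> x m)"
      using smult_assoc1[OF ak const family_closed(2)[OF single], of k l] by (simp add: mult_single)
    finally show ?case by (simp add: linear_extension_single[OF single])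
  next
    case (add f g)
    then have fg: "f \<in> truncation \<sigma> c" "g \<in> truncation \<sigma> c" by (simp_all add: truncation_def)
    have a': "Poly_Mapping.keys (Poly_Mapping.single a k) \<subseteq> sigma_M \<sigma>" using a by simp
    show ?case
      using add.IH linear_extension_add[OF fg]
        linear_extension_add[OF truncation_mult[OF a' fg(1)] truncation_mult[OF a' fg(2)]]
        smult_r_distr[OF ak linear_extension_closed[OF fg(1)] linear_extension_closed[OF fg(2)]]
      by (simp add: distrib_left)
  qed
qed

lemma linear_extension_mult:
  assumes r: "Poly_Mapping.keys r \<subseteq> sigma_M \<sigma>" and f: "f \<in> truncation \<sigma> c"
  shows "linear_extension c x (r * f) = r \<odot>\<^bsub>E\<^esub> linear_extension c x f"
  using r
proof (induction r rule: poly_mapping_on_induct)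
  case zero
  show ?case using smult_l_null[OF linear_extension_closed[OF f]] by (simp add: linear_extension_zero)
next
  case (single a k)
  then show ?case by (rule linear_extension_single_mult[OF _ f])
next
  case (add r s)
  then show ?case
    using linear_extension_add[OF truncation_mult[OF add.hyps(1) f] truncation_mult[OF add.hyps(2) f]]
      smult_l_distr[of r s, OF _ _ linear_extension_closed[OF f]]
    by (simp add: distrib_right)
qed

lemma linear_extension_in_lifting: "linear_extension c x \<in> carrier (lifting_component \<sigma> E c)"
  unfolding in_lifting_component_iff
proof (intro conjI ballI allI impI)
  show "linear_extension c x \<in> truncation \<sigma> c \<rightarrow>\<^sub>E carrier E"
    using linear_extension_closed by (auto simp: linear_extension_def)
  fix m and f :: "'m \<Rightarrow>\<^sub>0 'k" assume f: "Poly_Mapping.keys f \<subseteq> U_set \<sigma> c \<inter> {m}"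
  show "linear_extension c x f \<in> hcomp E m"
  proof (cases "Poly_Mapping.keys f = {}")
    case True
    then show ?thesis by (simp add: linear_extension_zero hcomp_zero)
  next
    case False
    then have K: "Poly_Mapping.keys f = {m}" using f by blast
    then have m: "m \<in> U_set \<sigma> c" using f by blast
    have "f = Poly_Mapping.single m (Poly_Mapping.lookup f m)"
      using K by (intro poly_mapping_eqI) (auto simp: lookup_single when_def in_keys_iff)
    then show ?thesis
      using linear_extension_single[OF m] hcomp_scalar[OF family_closed(1)[OF m]] by metis
  qed
qed (auto intro: linear_extension_add linear_extension_mult)

lemma evaluation_linear_extension: "evaluation c (linear_extension c x) = x"
proof (rule PiE_ext[of _ "U_set \<sigma> c" "\<lambda>_. carrier E"])
  have "y \<in> (U_set \<sigma> c \<rightarrow>\<^sub>E carrier E)" if "y \<in> carrier (limit_component \<sigma> E c)" for y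
    using that hcomp_closed by (fastforce simp: in_limit_component_iff)
  then show "evaluation c (linear_extension c x) \<in> (U_set \<sigma> c \<rightarrow>\<^sub>E carrier E)" "x \<in> (U_set \<sigma> c \<rightarrow>\<^sub>E carrier E)"
    using x evaluation_closed[OF linear_extension_in_lifting] by blast+
  fix m assume m: "m \<in> U_set \<sigma> c"
  then show "evaluation c (linear_extension c x) m = x m"
    using linear_extension_in_lifting linear_extension_single[OF m, of 1] smult_one[OF family_closed(2)[OF m]]
    by (simp add: evaluation_def chi_def)
qed

end

lemma evaluation_iso:
  "is_module_iso ring_of_type_algebra (lifting_component \<sigma> E c) (limit_component \<sigma> E c) (evaluation c)"
  unfolding is_module_iso_def
proof (intro conjI)
  let ?L = "lifting_component \<sigma> E c"
  interpret L: module ring_of_type_algebra ?L by (rule module_lifting_component)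
  show "module ring_of_type_algebra ?L" by (rule module_lifting_component)
  show "module ring_of_type_algebra (limit_component \<sigma> E c)" by (rule module_limit_component)
  show "bij_betw (evaluation c) (carrier ?L) (carrier (limit_component \<sigma> E c))"
  proof (rule bij_betw_imageI[OF evaluation_inj], intro equalityI subsetI)
    fix x assume x: "x \<in> carrier (limit_component \<sigma> E c)"
    show "x \<in> evaluation c ` carrier ?L"
      using evaluation_linear_extension[OF x] linear_extension_in_lifting[OF x] by (metis imageI)
  qed (auto intro: evaluation_closed)
  show "evaluation c \<in> module_hom ring_of_type_algebra ?L (limit_component \<sigma> E c)"
    unfolding module_hom_def
  proof (intro CollectI conjI ballI)
    show "evaluation c \<in> carrier ?L \<rightarrow>\<^sub>E carrier (limit_component \<sigma> E c)"
      using evaluation_closed by (auto simp: evaluation_def)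
    fix \<psi> assume \<psi>: "\<psi> \<in> carrier ?L"
    {
      fix \<eta> assume \<eta>: "\<eta> \<in> carrier ?L"
      have "\<psi> \<oplus>\<^bsub>?L\<^esub> \<eta> \<in> carrier ?L" by (rule L.M.a_closed[OF \<psi> \<eta>])
      then show "evaluation c (\<psi> \<oplus>\<^bsub>?L\<^esub> \<eta>) = evaluation c \<psi> \<oplus>\<^bsub>limit_component \<sigma> E c\<^esub> evaluation c \<eta>"
        using \<psi> \<eta> by (auto simp: evaluation_def chi_def single_in_truncation intro!: restrict_ext)
    }
  next
    fix k :: 'k and \<psi> assume \<psi>: "\<psi> \<in> carrier ?L"
    have "k \<odot>\<^bsub>?L\<^esub> \<psi> \<in> carrier ?L" using L.smult_closed[of k, OF _ \<psi>] by simp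
    then show "evaluation c (k \<odot>\<^bsub>?L\<^esub> \<psi>) = k \<odot>\<^bsub>limit_component \<sigma> E c\<^esub> evaluation c \<psi>"
      using \<psi> by (auto simp: evaluation_def chi_def single_in_truncation intro!: restrict_ext)
  qed
qed

lemma lifting_restrict_closed:
  assumes a: "a \<in> N_rays \<sigma>" and \<psi>: "\<psi> \<in> carrier (lifting_component \<sigma> E c)"
  shows "restrict \<psi> (truncation \<sigma> (a + c)) \<in> carrier (lifting_component \<sigma> E (a + c))"
proof -
  have sub: "f \<in> truncation \<sigma> c" if "f \<in> truncation \<sigma> (a + c)" for f :: "'m \<Rightarrow>\<^sub>0 'k"
    using truncation_antimono[OF a] that by blast
  have "Poly_Mapping.keys f \<subseteq> U_set \<sigma> c \<inter> {m}" if "Poly_Mapping.keys f \<subseteq> U_set \<sigma> (a + c) \<inter> {m}"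
    for f :: "'m \<Rightarrow>\<^sub>0 'k" and m
    using U_set_antimono[OF a] that by blast
  then show ?thesis
    using \<psi> sub unfolding in_lifting_component_iff
    by (auto simp: truncation_add truncation_mult homogeneous_in_truncation)
qed

lemma limit_restrict_closed:
  assumes a: "a \<in> N_rays \<sigma>" and x: "x \<in> carrier (limit_component \<sigma> E c)"
  shows "restrict x (U_set \<sigma> (a + c)) \<in> carrier (limit_component \<sigma> E (a + c))"
proof -
  have "m \<in> U_set \<sigma> c" if "m \<in> U_set \<sigma> (a + c)" for m
    using U_set_antimono[OF a] that by blast
  then show ?thesis
    using x U_set_add unfolding in_limit_component_iff by auto
qed

lemma graded_system_lifting:
  "graded_system (N_rays \<sigma>) (Z_rays \<sigma>) (lifting_component \<sigma> E)
    (\<lambda>c c' \<phi>. restrict \<phi> (carrier (S_shift \<sigma> (- c'))))"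
  unfolding S_shift_uminus
proof (rule graded_system.intro)
  fix c \<psi> assume "\<psi> \<in> carrier (lifting_component \<sigma> E c)"
  then show "restrict \<psi> (truncation \<sigma> c) = \<psi>" by (auto simp: in_lifting_component_iff PiE_restrict)
next
  fix c a b and \<psi> :: "('m \<Rightarrow>\<^sub>0 'k) \<Rightarrow> 'e" assume a: "a \<in> N_rays \<sigma>"
  show "restrict (restrict \<psi> (truncation \<sigma> (b + c))) (truncation \<sigma> (a + (b + c))) =
      restrict \<psi> (truncation \<sigma> (a + (b + c)))"
    by (simp add: Int_absorb1 truncation_antimono[OF a])
next
  fix c a \<psi> \<eta> and k :: 'k
  assume a: "a \<in> N_rays \<sigma>"
  have "f \<in> truncation \<sigma> c" if "f \<in> truncation \<sigma> (a + c)" for f :: "'m \<Rightarrow>\<^sub>0 'k"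
    using truncation_antimono[OF a] that by blast
  then show "restrict (\<psi> \<oplus>\<^bsub>lifting_component \<sigma> E c\<^esub> \<eta>) (truncation \<sigma> (a + c)) =
      restrict \<psi> (truncation \<sigma> (a + c)) \<oplus>\<^bsub>lifting_component \<sigma> E (a + c)\<^esub> restrict \<eta> (truncation \<sigma> (a + c))"
    "restrict (k \<odot>\<^bsub>lifting_component \<sigma> E c\<^esub> \<psi>) (truncation \<sigma> (a + c)) =
      k \<odot>\<^bsub>lifting_component \<sigma> E (a + c)\<^esub> restrict \<psi> (truncation \<sigma> (a + c))"
    by (auto intro!: restrict_ext)
qed (simp_all add: N_rays_zero N_rays_add N_rays_subset Z_rays_diff module_lifting_component lifting_restrict_closed)

lemma graded_system_limit:
  "graded_system (N_rays \<sigma>) (Z_rays \<sigma>) (limit_component \<sigma> E) (\<lambda>c c' x. restrict x (U_set \<sigma> c'))"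
proof (rule graded_system.intro)
  fix c x assume "x \<in> carrier (limit_component \<sigma> E c)"
  then show "restrict x (U_set \<sigma> c) = x" by (auto simp: in_limit_component_iff PiE_restrict)
next
  fix c a b and x :: "'m \<Rightarrow> 'e" assume a: "a \<in> N_rays \<sigma>"
  show "restrict (restrict x (U_set \<sigma> (b + c))) (U_set \<sigma> (a + (b + c))) =
      restrict x (U_set \<sigma> (a + (b + c)))"
    using U_set_antimono[OF a, of "b + c"] by (simp add: Int_absorb1)
next
  fix c a x y and k :: 'k
  assume a: "a \<in> N_rays \<sigma>"
  have "m \<in> U_set \<sigma> c" if "m \<in> U_set \<sigma> (a + c)" for m
    using U_set_antimono[OF a] that by blast
  then show "restrict (x \<oplus>\<^bsub>limit_component \<sigma> E c\<^esub> y) (U_set \<sigma> (a + c)) =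
      restrict x (U_set \<sigma> (a + c)) \<oplus>\<^bsub>limit_component \<sigma> E (a + c)\<^esub> restrict y (U_set \<sigma> (a + c))"
    "restrict (k \<odot>\<^bsub>limit_component \<sigma> E c\<^esub> x) (U_set \<sigma> (a + c)) =
      k \<odot>\<^bsub>limit_component \<sigma> E (a + c)\<^esub> restrict x (U_set \<sigma> (a + c))"
    by (auto intro!: restrict_ext)
qed (simp_all add: N_rays_zero N_rays_add N_rays_subset Z_rays_diff module_limit_component limit_restrict_closed)

lemma lifting_iso_limit:
  "is_graded_iso (N_rays \<sigma>) (Z_rays \<sigma>) (lifting \<sigma> E) (limit_module \<sigma> E)
    (\<lambda>x\<in>carrier (lifting \<sigma> E). \<lambda>c\<in>Z_rays \<sigma>. evaluation c (x c))"
  unfolding lifting_def limit_module_def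
proof (rule direct_sum_graded_iso[OF graded_system_lifting graded_system_limit evaluation_iso])
  fix c a and \<psi> :: "('m \<Rightarrow>\<^sub>0 'k) \<Rightarrow> 'e"
  assume a: "a \<in> N_rays \<sigma>" and \<psi>: "\<psi> \<in> carrier (lifting_component \<sigma> E c)"
  show "evaluation (a + c) (restrict \<psi> (carrier (S_shift \<sigma> (- (a + c))))) =
      restrict (evaluation c \<psi>) (U_set \<sigma> (a + c))"
    unfolding S_shift_uminus
  proof
    fix m
    show "evaluation (a + c) (restrict \<psi> (truncation \<sigma> (a + c))) m =
        restrict (evaluation c \<psi>) (U_set \<sigma> (a + c)) m"
      using \<psi> lifting_restrict_closed[OF a \<psi>] U_set_antimono[OF a, of c]
      by (auto simp: evaluation_def chi_def single_in_truncation)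
  qed
qed

end

section \<open>Naturality in the module\<close>

text \<open>
  Both sides send a character \<open>\<chi>(m)\<close> to \<open>f (\<psi> (\<chi>(m)))\<close>. The first claim is needed because evaluation is
  only meaningful on the lifting component of \<open>E'\<close>.
\<close>

lemma evaluation_natural:
  fixes E :: "('m::ab_group_add \<Rightarrow>\<^sub>0 'k::field, 'e, 'm) graded_module"
  assumes E: "toric_module \<sigma> E" and E': "toric_module \<sigma> E'"
    and f: "f \<in> graded_hom (sigma_M \<sigma>) UNIV E E'" and \<psi>: "\<psi> \<in> carrier (lifting_component \<sigma> E c)"
  shows "lifting_component_map \<sigma> f c \<psi> \<in> carrier (lifting_component \<sigma> E' c)"
    and "toric_module.evaluation \<sigma> E' c (lifting_component_map \<sigma> f c \<psi>) =
      limit_component_map \<sigma> f c (toric_module.evaluation \<sigma> E c \<psi>)"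
proof -
  interpret E: toric_module \<sigma> E by (rule E)
  interpret E': toric_module \<sigma> E' by (rule E')
  have f_closed: "f x \<in> carrier E'" if "x \<in> carrier E" for x
    using f that by (auto simp: graded_hom_def module_hom_def)
  have f_add: "f (x \<oplus>\<^bsub>E\<^esub> y) = f x \<oplus>\<^bsub>E'\<^esub> f y" if "x \<in> carrier E" "y \<in> carrier E" for x y
    using f that by (simp add: graded_hom_def module_hom_def)
  have f_smult: "f (r \<odot>\<^bsub>E\<^esub> x) = r \<odot>\<^bsub>E'\<^esub> f x" if "Poly_Mapping.keys r \<subseteq> sigma_M \<sigma>" "x \<in> carrier E" for r x
    using f that by (simp add: graded_hom_def module_hom_def)
  have f_hcomp: "f x \<in> hcomp E' m" if "x \<in> hcomp E m" for x m
    using f that by (auto simp: graded_hom_def)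
  have map: "lifting_component_map \<sigma> f c \<psi> = (\<lambda>g\<in>truncation \<sigma> c. f (\<psi> g))"
    by (simp add: lifting_component_map_def compose_def S_shift_uminus)
  show closed: "lifting_component_map \<sigma> f c \<psi> \<in> carrier (lifting_component \<sigma> E' c)"
    unfolding E'.in_lifting_component_iff map
  proof (intro conjI ballI allI impI)
    show "(\<lambda>g\<in>truncation \<sigma> c. f (\<psi> g)) \<in> truncation \<sigma> c \<rightarrow>\<^sub>E carrier E'"
      using f_closed E.lifting_val[OF \<psi>] by auto
  next
    fix g h :: "'m \<Rightarrow>\<^sub>0 'k" assume gh: "g \<in> truncation \<sigma> c" "h \<in> truncation \<sigma> c"
    then have "\<psi> (g + h) = \<psi> g \<oplus>\<^bsub>E\<^esub> \<psi> h" using \<psi> by (simp add: E.in_lifting_component_iff)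
    then show "(\<lambda>g\<in>truncation \<sigma> c. f (\<psi> g)) (g + h) =
        (\<lambda>g\<in>truncation \<sigma> c. f (\<psi> g)) g \<oplus>\<^bsub>E'\<^esub> (\<lambda>g\<in>truncation \<sigma> c. f (\<psi> g)) h"
      using gh f_add E.lifting_val[OF \<psi>] by (simp add: truncation_add)
  next
    fix r g :: "'m \<Rightarrow>\<^sub>0 'k" assume r: "Poly_Mapping.keys r \<subseteq> sigma_M \<sigma>" and g: "g \<in> truncation \<sigma> c"
    show "(\<lambda>g\<in>truncation \<sigma> c. f (\<psi> g)) (r * g) = r \<odot>\<^bsub>E'\<^esub> (\<lambda>g\<in>truncation \<sigma> c. f (\<psi> g)) g"
      using g E.truncation_mult[OF r g] E.lifting_mult[OF \<psi> r g] f_smult[OF r E.lifting_val[OF \<psi> g]] by simp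
  next
    fix m and g :: "'m \<Rightarrow>\<^sub>0 'k" assume g: "Poly_Mapping.keys g \<subseteq> U_set \<sigma> c \<inter> {m}"
    then have "\<psi> g \<in> hcomp E m" using \<psi> by (simp add: E.in_lifting_component_iff)
    then show "(\<lambda>g\<in>truncation \<sigma> c. f (\<psi> g)) g \<in> hcomp E' m"
      using f_hcomp E.homogeneous_in_truncation[OF g] by simp
  qed
  show "E'.evaluation c (lifting_component_map \<sigma> f c \<psi>) = limit_component_map \<sigma> f c (E.evaluation c \<psi>)"
    using \<psi> closed unfolding map
    by (auto simp: E.evaluation_def E'.evaluation_def limit_component_map_def compose_def chi_def
        single_in_truncation intro!: restrict_ext)
qed

text \<open>
  Supports do not grow because \<open>f\<close> preserves zero.
\<close>

lemma lifting_map_closed: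
  fixes E :: "('m::ab_group_add \<Rightarrow>\<^sub>0 'k::field, 'e, 'm) graded_module"
  assumes E: "toric_module \<sigma> E" and E': "toric_module \<sigma> E'"
    and f: "f \<in> graded_hom (sigma_M \<sigma>) UNIV E E'" and x: "x \<in> carrier (lifting \<sigma> E)"
  shows "lifting_map \<sigma> f x \<in> carrier (lifting \<sigma> E')"
proof -
  interpret E: toric_module \<sigma> E by (rule E)
  interpret E': toric_module \<sigma> E' by (rule E')
  note L = graded_system.carrier_M[OF E.graded_system_lifting, folded lifting_def]
  note L' = graded_system.carrier_M[OF E'.graded_system_lifting, folded lifting_def]
  have "f \<zero>\<^bsub>E\<^esub> = \<zero>\<^bsub>E'\<^esub>"
  proof (rule module_hom_zero)
    show "f \<in> module_hom (monoid_algebra (sigma_M \<sigma>)) E E'" using f by (simp add: graded_hom_def)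
  qed (rule E.abelian_group_axioms E'.abelian_group_axioms)+
  then have zero: "lifting_component_map \<sigma> f c \<zero>\<^bsub>lifting_component \<sigma> E c\<^esub> = \<zero>\<^bsub>lifting_component \<sigma> E' c\<^esub>" for c
    by (auto simp: lifting_component_map_def compose_def S_shift_uminus intro!: restrict_ext)
  have "{c\<in>Z_rays \<sigma>. lifting_map \<sigma> f x c \<noteq> \<zero>\<^bsub>lifting_component \<sigma> E' c\<^esub>}
      \<subseteq> {c\<in>Z_rays \<sigma>. x c \<noteq> \<zero>\<^bsub>lifting_component \<sigma> E c\<^esub>}"
    using zero by (auto simp: lifting_map_def simp del: E.lifting_component_simps E'.lifting_component_simps)
  moreover have "finite {c\<in>Z_rays \<sigma>. x c \<noteq> \<zero>\<^bsub>lifting_component \<sigma> E c\<^esub>}" using x unfolding L by blast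
  ultimately have "finite {c\<in>Z_rays \<sigma>. lifting_map \<sigma> f x c \<noteq> \<zero>\<^bsub>lifting_component \<sigma> E' c\<^esub>}"
    by (rule finite_subset)
  moreover have "lifting_map \<sigma> f x \<in> (\<Pi>\<^sub>E c\<in>Z_rays \<sigma>. carrier (lifting_component \<sigma> E' c))"
    using x evaluation_natural(1)[OF E E' f] unfolding L lifting_map_def by auto
  ultimately show ?thesis unfolding L' by blast
qed

theorem proposition5p4:
  fixes \<sigma> :: "'m::ab_group_add N_real set" and d :: nat
  assumes "free_abelian_of_rank TYPE('m) d"
    and "rational_polyhedral_cone \<sigma>" and "strictly_convex_cone \<sigma>"
  shows "\<exists>(\<Phi> :: ('m \<Rightarrow>\<^sub>0 'k::alg_closed_field, 'e, 'm) graded_module \<Rightarrow>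
                ('m ray_index \<Rightarrow> ('m \<Rightarrow>\<^sub>0 'k) \<Rightarrow> 'e) \<Rightarrow> 'm ray_index \<Rightarrow> 'm \<Rightarrow> 'e)
            (\<phi> :: ('m \<Rightarrow>\<^sub>0 'k, 'e, 'm) graded_module \<Rightarrow> 'm ray_index \<Rightarrow>
                (('m \<Rightarrow>\<^sub>0 'k) \<Rightarrow> 'e) \<Rightarrow> 'm \<Rightarrow> 'e).
    (\<forall>E. is_graded_module (sigma_M \<sigma>) UNIV E \<longrightarrow>
       is_graded_iso (N_rays \<sigma>) (Z_rays \<sigma>) (lifting \<sigma> E) (limit_module \<sigma> E) (\<Phi> E) \<and>
       (\<forall>c\<in>Z_rays \<sigma>. is_module_iso (ring_of_type_algebra :: 'k ring)
          (lifting_component \<sigma> E c) (limit_component \<sigma> E c) (\<phi> E c)) \<and>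
       (\<forall>x\<in>carrier (lifting \<sigma> E). \<forall>c\<in>Z_rays \<sigma>. \<Phi> E x c = \<phi> E c (x c))) \<and>
    (\<forall>E E' f. is_graded_module (sigma_M \<sigma>) UNIV E \<and> is_graded_module (sigma_M \<sigma>) UNIV E' \<and>
       f \<in> graded_hom (sigma_M \<sigma>) UNIV E E' \<longrightarrow>
       (\<forall>x\<in>carrier (lifting \<sigma> E). \<Phi> E' (lifting_map \<sigma> f x) = limit_map \<sigma> f (\<Phi> E x)) \<and>
       (\<forall>c\<in>Z_rays \<sigma>. \<forall>x\<in>carrier (lifting_component \<sigma> E c).
          \<phi> E' c (lifting_component_map \<sigma> f c x) = limit_component_map \<sigma> f c (\<phi> E c x)))"
proof (intro exI conjI allI impI ballI)
  let ?\<phi> = "toric_module.evaluation \<sigma>"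
  let ?\<Phi> = "\<lambda>E. \<lambda>x\<in>carrier (lifting \<sigma> E). \<lambda>c\<in>Z_rays \<sigma>. ?\<phi> E c (x c)"
  have toric: "toric_module \<sigma> E" if "is_graded_module (sigma_M \<sigma>) UNIV E"
    for E :: "('m \<Rightarrow>\<^sub>0 'k, 'e, 'm) graded_module"
    using that assms(2,3) by unfold_locales
  {
    fix E :: "('m \<Rightarrow>\<^sub>0 'k, 'e, 'm) graded_module"
    assume "is_graded_module (sigma_M \<sigma>) UNIV E"
    then interpret E: toric_module \<sigma> E by (rule toric)
    show "is_graded_iso (N_rays \<sigma>) (Z_rays \<sigma>) (lifting \<sigma> E) (limit_module \<sigma> E) (?\<Phi> E)"
      by (rule E.lifting_iso_limit)
    fix c
    show "is_module_iso ring_of_type_algebra (lifting_component \<sigma> E c) (limit_component \<sigma> E c) (?\<phi> E c)"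
      by (rule E.evaluation_iso)
    fix x assume "x \<in> carrier (lifting \<sigma> E)" "c \<in> Z_rays \<sigma>"
    then show "?\<Phi> E x c = ?\<phi> E c (x c)" by simp
  }
  fix E E' :: "('m \<Rightarrow>\<^sub>0 'k, 'e, 'm) graded_module" and f
  assume "is_graded_module (sigma_M \<sigma>) UNIV E \<and> is_graded_module (sigma_M \<sigma>) UNIV E' \<and>
       f \<in> graded_hom (sigma_M \<sigma>) UNIV E E'"
  then have E: "toric_module \<sigma> E" and E': "toric_module \<sigma> E'" and f: "f \<in> graded_hom (sigma_M \<sigma>) UNIV E E'"
    using toric by auto
  {
    fix c x assume "x \<in> carrier (lifting_component \<sigma> E c)"
    then show "?\<phi> E' c (lifting_component_map \<sigma> f c x) = limit_component_map \<sigma> f c (?\<phi> E c x)"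
      by (rule evaluation_natural(2)[OF E E' f])
  }
  fix x assume x: "x \<in> carrier (lifting \<sigma> E)"
  have comp: "x c \<in> carrier (lifting_component \<sigma> E c)" if "c \<in> Z_rays \<sigma>" for c
    using graded_system.M_apply_closed[OF toric_module.graded_system_lifting[OF E] _ that] x
    by (simp add: lifting_def)
  show "?\<Phi> E' (lifting_map \<sigma> f x) = limit_map \<sigma> f (?\<Phi> E x)"
    using x lifting_map_closed[OF E E' f x] evaluation_natural(2)[OF E E' f comp]
    by (auto simp: limit_map_def lifting_map_def intro!: restrict_ext)
qed

end
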